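(* Let $\gamma<0$, $0<\alpha<1$ and $\tau_1,\tau_2>0$, and define $$k_*=\frac{(\tau_1+\tau_2)^{1+\frac{\tau_1}{\tau_2}}}{\tau_2\,e^{\gamma\tau_1}\,\tau_1^{\tau_1/\tau_2}}\left[\left(\frac{\log\left(1+\frac{\tau_2}{\tau_1}\right)}{\tau_2}-\gamma\right)^{\alpha}+\gamma\right].$$ Then for every $k>0$ with $k>k_*$ the characteristic equation $F(\lambda)=0$, where $$F(\lambda)=\lambda^\alpha+\gamma-ke^{-\lambda\tau_1}+ke^{-(\lambda+\gamma)\tau_2-\lambda\tau_1},$$ has a root with positive real part; hence, for all such $k$, the equilibrium $x_*=0$ of $$D^\alpha x(t)=-\gamma x(t)+g\bigl(x(t-\tau_1)\bigr)-e^{-\gamma\tau_2}\,g\bigl(x(t-\tau_1-\tau_2)\bigr),$$ where $g\in C^1(\mathbb{R})$ is nonlinear with $g(0)=0$ and $g'(0)=k$, is unstable.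
   Context: $D^\alpha$ is the Caputo fractional derivative of order $\alpha$ with base point $0$; solutions are determined by a continuous history on $[-(\tau_1+\tau_2),0]$. $\lambda^\alpha$ denotes the principal branch. Instability of the equilibrium is in the usual local sense and is studied via the linearization at $0$, $$D^\alpha x(t)=-\gamma x(t)+kx(t-\tau_1)-ke^{-\gamma\tau_2}x(t-\tau_1-\tau_2),$$ whose characteristic equation is $F(\lambda)=0$. *)

theory Defs
  imports "HOL-Analysis.Analysis"
begin

text \<open>
  Caputo derivative of order \<open>\<alpha>\<close> (for \<open>0 < \<alpha> < 1\<close>) with base point \<open>0\<close>, in the form
  \[ D^\alpha x(t) = \frac{1}{\Gamma(1-\alpha)} \frac{d}{dt} \int_0^t (t-s)^{-\alpha} (x(s) - x(0)) \, ds . \]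
  For locally absolutely continuous \<open>x\<close> this is almost everywhere (and everywhere on \<open>t > 0\<close> if
  \<open>x\<close> is continuously differentiable) the integral of \<open>(t-s)\<^sup>-\<^sup>\<alpha> x'(s)\<close> over \<open>[0,t]\<close> divided by
  \<open>\<Gamma>(1-\<alpha>)\<close>. The present form does not presuppose that \<open>x'\<close> exists. This is needed because the
  solution issuing from a merely continuous history need not be absolutely continuous.
\<close>

definition has_caputo_derivative :: "real \<Rightarrow> (real \<Rightarrow> real) \<Rightarrow> real \<Rightarrow> real \<Rightarrow> bool" where
  "has_caputo_derivative \<alpha> x D t \<longleftrightarrow>
     ((\<lambda>u. 1 / Gamma (1 - \<alpha>) * integral {0..u} (\<lambda>s. (u - s) powr (- \<alpha>) * (x s - x 0)))
        has_real_derivative D) (at t)"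

text \<open>
  In \<open>D\<^sup>\<alpha> x(t) = R x t\<close> the right-hand side \<open>R\<close> may use the values of \<open>x\<close> on \<open>[t - r, t]\<close>;
  the restriction of \<open>x\<close> to \<open>[-r, 0]\<close> is the history.
\<close>

definition caputo_dde_solution ::
  "real \<Rightarrow> real \<Rightarrow> ((real \<Rightarrow> real) \<Rightarrow> real \<Rightarrow> real) \<Rightarrow> (real \<Rightarrow> real) \<Rightarrow> bool" where
  "caputo_dde_solution \<alpha> r R x \<longleftrightarrow>
     continuous_on {- r..} x \<and> (\<forall>t>0. has_caputo_derivative \<alpha> x (R x t) t)"

definition equilibrium ::
  "real \<Rightarrow> real \<Rightarrow> ((real \<Rightarrow> real) \<Rightarrow> real \<Rightarrow> real) \<Rightarrow> real \<Rightarrow> bool" where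
  "equilibrium \<alpha> r R xe \<longleftrightarrow> caputo_dde_solution \<alpha> r R (\<lambda>_. xe)"

definition stable ::
  "real \<Rightarrow> real \<Rightarrow> ((real \<Rightarrow> real) \<Rightarrow> real \<Rightarrow> real) \<Rightarrow> real \<Rightarrow> bool" where
  "stable \<alpha> r R xe \<longleftrightarrow>
     (\<forall>\<epsilon>>0. \<exists>\<delta>>0. \<forall>x. caputo_dde_solution \<alpha> r R x \<longrightarrow>
        (\<forall>t\<in>{- r..0}. \<bar>x t - xe\<bar> < \<delta>) \<longrightarrow> (\<forall>t\<ge>0. \<bar>x t - xe\<bar> < \<epsilon>))"

definition unstable_equilibrium ::
  "real \<Rightarrow> real \<Rightarrow> ((real \<Rightarrow> real) \<Rightarrow> real \<Rightarrow> real) \<Rightarrow> real \<Rightarrow> bool" where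
  "unstable_equilibrium \<alpha> r R xe \<longleftrightarrow> equilibrium \<alpha> r R xe \<and> \<not> stable \<alpha> r R xe"

definition delay_rhs ::
  "real \<Rightarrow> real \<Rightarrow> real \<Rightarrow> (real \<Rightarrow> real) \<Rightarrow> (real \<Rightarrow> real) \<Rightarrow> real \<Rightarrow> real" where
  "delay_rhs \<gamma> \<tau>1 \<tau>2 g x t =
     - \<gamma> * x t + g (x (t - \<tau>1)) - exp (- \<gamma> * \<tau>2) * g (x (t - \<tau>1 - \<tau>2))"

text \<open>Complex \<open>powr\<close> is defined through \<open>Ln\<close>, hence is the principal branch.\<close>

definition char_fun :: "real \<Rightarrow> real \<Rightarrow> real \<Rightarrow> real \<Rightarrow> real \<Rightarrow> complex \<Rightarrow> complex" where
  "char_fun \<alpha> \<gamma> \<tau>1 \<tau>2 k z =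
     z powr of_real \<alpha> + of_real \<gamma> - of_real k * exp (- z * of_real \<tau>1)
     + of_real k * exp (- (z + of_real \<gamma>) * of_real \<tau>2 - z * of_real \<tau>1)"

definition k_star :: "real \<Rightarrow> real \<Rightarrow> real \<Rightarrow> real \<Rightarrow> real" where
  "k_star \<alpha> \<gamma> \<tau>1 \<tau>2 =
     (\<tau>1 + \<tau>2) powr (1 + \<tau>1 / \<tau>2) / (\<tau>2 * exp (\<gamma> * \<tau>1) * \<tau>1 powr (\<tau>1 / \<tau>2))
     * ((ln (1 + \<tau>2 / \<tau>1) / \<tau>2 - \<gamma>) powr \<alpha> + \<gamma>)"

end

theory Submission
  imports Defs "HOL-Probability.Characteristic_Functions" "HOL-Complex_Analysis.Conformal_Mappings"
begin

text \<open>
  \<^bold>\<open>Root.\<close> For real \<open>x > 0\<close> the characteristic function is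
  \<open>x powr \<alpha> + \<gamma> - k exp (- x \<tau>1) (1 - exp (- (x + \<gamma>) \<tau>2))\<close>. The threshold \<open>k_star\<close> is the value of
  \<open>k\<close> at which this vanishes at the point maximising the exponential factor. Above the threshold the
  function is negative there and positive far out, which gives a real positive root
  (\<open>char_fun_positive_root\<close>).

  \<^bold>\<open>Instability.\<close> Nothing excludes complex characteristic roots further to the right, so the real
  root need not govern the growth of solutions, and \<open>g\<close> is only \<open>C\<^sup>1\<close>; both stand in the way of a
  comparison with an exponential solution of the linearization. The argument is instead a dichotomy in
  the Laplace domain (\<open>not_stable_of_positive_root\<close>). Take a small history vanishing at \<open>0\<close> and suppose that
  stability keeps its solution \<open>x\<close> close to \<open>0\<close> for all times. Then \<open>x\<close> has a Laplace transform \<open>X\<close> on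
  the right half-plane, and with \<open>F\<close> for the characteristic function and \<open>e = exp (- \<gamma> \<tau>2)\<close>,
  \<open>F(s) X(s) = (exp (- s \<tau>1) - e exp (- s (\<tau>1 + \<tau>2))) N(s) - e P(s)\<close>,
  where \<open>N\<close> is the transform of the remainder \<open>g (x t) - k x t\<close> and \<open>P\<close> that of the history term
  (\<open>laplace_delay_equation\<close>). On a vertical line between the imaginary axis and the root
  on which \<open>F\<close> has no zeros (\<open>char_fun_zero_free_line\<close>), \<open>F\<close> is bounded below and Plancherel's inequality
  (\<open>plancherel_domination\<close>) bounds an exponentially weighted \<open>L\<^sup>2\<close> norm of \<open>x\<close> by the size of the history.
  At the root the left-hand side vanishes, so the history term equals the remainder term; but the
  remainder is smaller than the history by an arbitrarily small factor, which is a contradiction.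

  \<^bold>\<open>Existence.\<close> Refuting stability requires a solution. The fractional initial value problem is
  reduced to a Volterra equation with the weakly singular kernel of the fractional integral
  (\<open>caputo_derivative_frac_integral\<close>), which is solved by a contraction argument on successive delay
  intervals (\<open>volterra_delay_solution\<close>).
\<close>

section \<open>The fractional kernel and its Laplace transform\<close>

text \<open>
  The Riemann--Liouville kernel: convolution with it is the fractional integral of order \<open>a\<close> with
  base point \<open>0\<close>, applied to functions that vanish for negative times. Extending it by zero turns
  every integral below into an integral over the whole line, so that translations are free.
\<close>

definition frac_kernel :: "real \<Rightarrow> real \<Rightarrow> real" where
  "frac_kernel a t = (if t > 0 then t powr (a - 1) / Gamma a else 0)"

lemma frac_kernel_measurable [measurable]: "frac_kernel a \<in> borel_measurable borel"
  unfolding frac_kernel_def by measurable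

lemma frac_kernel_nonneg: "a > 0 \<Longrightarrow> frac_kernel a t \<ge> 0"
  using Gamma_real_pos[of a] by (simp add: frac_kernel_def)

lemma laplace_frac_kernel_real:
  assumes "a > 0" and "r > 0"
  shows "has_bochner_integral lborel (\<lambda>t. frac_kernel a t * exp (- r * t)) (r powr (- a))"
proof -
  have pos: "Gamma a > 0" using assms by (simp add: Gamma_real_pos)
  have "has_bochner_integral lborel (\<lambda>t. indicator {0..} t * t powr (a - 1) / exp t) (Gamma a)"
    by (rule has_bochner_integral_nn_integral)
      (use assms pos in \<open>auto simp: Gamma_conv_nn_integral_real[symmetric]\<close>)
  then have "has_bochner_integral lborel
      (\<lambda>t. indicator {0..} (0 + r * t) * (0 + r * t) powr (a - 1) / exp (0 + r * t)) (Gamma a /\<^sub>R \<bar>r\<bar>)"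
    using lborel_has_bochner_integral_real_affine_iff[of r "\<lambda>t. indicator {0..} t * t powr (a - 1) / exp t" "Gamma a" 0]
      assms by simp
  then have "has_bochner_integral lborel
      (\<lambda>t. indicator {0..} (0 + r * t) * (0 + r * t) powr (a - 1) / exp (0 + r * t) * (r powr (1 - a) / Gamma a))
        ((Gamma a /\<^sub>R \<bar>r\<bar>) * (r powr (1 - a) / Gamma a))"
    by (intro has_bochner_integral_mult_left) auto
  moreover have "(Gamma a /\<^sub>R \<bar>r\<bar>) * (r powr (1 - a) / Gamma a) = r powr (- a)"
  proof -
    have "r * r powr (- a) = r powr (1 - a)" using assms by (simp add: powr_diff powr_minus field_simps)
    then show ?thesis using assms less_imp_neq[OF pos] by (simp add: field_simps)
  qed
  moreover have "indicator {0..} (0 + r * t) * (0 + r * t) powr (a - 1) / exp (0 + r * t) * (r powr (1 - a) / Gamma a)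
      = frac_kernel a t * exp (- r * t)" for t
  proof (cases "t > 0")
    case True
    have "(r * t) powr (a - 1) * r powr (1 - a) = t powr (a - 1)"
      using assms True by (simp add: powr_mult powr_diff)
    then show ?thesis using True assms pos
      by (simp add: frac_kernel_def exp_minus field_simps)
  next
    case False
    then show ?thesis using assms by (cases "t = 0") (auto simp: frac_kernel_def indicator_def zero_le_mult_iff)
  qed
  ultimately show ?thesis by simp
qed

text \<open>
  Multiplying by a power of \<open>t\<close> raises the order of the kernel. This is what makes the termwise
  integration in the next lemma explicit.
\<close>

lemma frac_kernel_moment:
  assumes "a > 0"
  shows "t ^ n * frac_kernel a t = pochhammer a n * frac_kernel (a + real n) t"
proof -
  have "a \<notin> \<int>\<^sub>\<le>\<^sub>0" using assms nonpos_Ints_def by (auto simp: nonpos_Ints_def)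
  then have "pochhammer a n = Gamma (a + real n) / Gamma a"
    by (rule pochhammer_Gamma)
  moreover have "Gamma (a + real n) > 0" "Gamma a > 0" using assms by (auto intro!: Gamma_real_pos)
  moreover have "t powr (a + real n - 1) = t ^ n * t powr (a - 1)" if "t > 0"
    using that by (simp add: powr_add powr_diff powr_realpow)
  ultimately show ?thesis by (simp add: frac_kernel_def)
qed

text \<open>
  For real \<open>s\<close> this is the Gamma integral after scaling. A complex \<open>s\<close> in the right half-plane lies
  in the disc around a large real \<open>r\<close> that reaches down to \<open>0\<close>; expanding
  \<open>exp (- (s - r) t)\<close> as a power series and integrating term by term turns the real case into the
  binomial series for the principal branch of \<open>s powr (- a)\<close>.
\<close>

lemma laplace_frac_kernel:
  fixes s :: complex
  assumes "a > 0" and "Re s > 0"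
  shows "has_bochner_integral lborel (\<lambda>t. of_real (frac_kernel a t) * exp (- s * of_real t)) (s powr (- of_real a))"
proof -
  \<comment> \<open>With this centre, \<open>(norm (s - r))\<^sup>2 = r\<^sup>2 - (norm s)\<^sup>2\<close>.\<close>
  define r where "r = (norm s)\<^sup>2 / Re s"
  have s0: "s \<noteq> 0" using assms by auto
  have r0: "r > 0" using assms s0 by (simp add: r_def)
  define w where "w = s - of_real r"
  have "(norm w)\<^sup>2 = (norm s)\<^sup>2 - 2 * r * Re s + r\<^sup>2"
    unfolding w_def cmod_power2 by (simp add: power2_eq_square algebra_simps)
  also have "\<dots> = r\<^sup>2 - (norm s)\<^sup>2" using assms by (simp add: r_def)
  also have "\<dots> < r\<^sup>2" using s0 by simp
  finally have wr: "norm w < r" using r0 power2_less_imp_less by fastforce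
  define f where "f n t = (of_real (frac_kernel a t * exp (- r * t)) * ((- w * of_real t) ^ n /\<^sub>R fact n) :: complex)" for n t
  have hb: "has_bochner_integral lborel (\<lambda>t. t ^ n * (frac_kernel a t * exp (- r * t)))
      (pochhammer a n * r powr (- a - real n))" for n
  proof -
    have "has_bochner_integral lborel (\<lambda>t. pochhammer a n * (frac_kernel (a + real n) t * exp (- r * t)))
      (pochhammer a n * r powr (- (a + real n)))"
      using assms r0 by (intro has_bochner_integral_mult_right laplace_frac_kernel_real) auto
    moreover have "pochhammer a n * (frac_kernel (a + real n) t * exp (- r * t)) = t ^ n * (frac_kernel a t * exp (- r * t))" for t
      using frac_kernel_moment[OF assms(1), of t n] by (metis mult.assoc)
    moreover have "- (a + real n) = - a - real n" by simp
    ultimately show ?thesis by (simp only:)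
  qed
  have f_eq: "f n t = of_real (t ^ n * (frac_kernel a t * exp (- r * t))) * ((- w) ^ n / fact n)" for n t
    unfolding f_def power_mult_distrib by (simp add: scaleR_conv_of_real divide_simps)
  have hf: "has_bochner_integral lborel (f n) (of_real (pochhammer a n * r powr (- a - real n)) * ((- w) ^ n / fact n))" for n
    unfolding f_eq
    by (intro has_bochner_integral_mult_left has_bochner_integral_of_real hb)
  have coeff: "of_real (pochhammer a n * r powr (- a - real n)) * ((- y) ^ n / fact n)
     = of_real (r powr (- a)) * ((- of_real a gchoose n) * (y / of_real r) ^ n)" for n and y :: complex
  proof -
    have "(- of_real a gchoose n) = (-1) ^ n * of_real (pochhammer a n) / (fact n :: complex)"
      by (simp add: gbinomial_pochhammer pochhammer_of_real)
    moreover have "r powr (- a - real n) = r powr (- a) / r ^ n"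
      using r0 by (simp add: powr_diff powr_realpow)
    moreover have "(- y) ^ n = (-1) ^ n * y ^ n" by (rule power_minus)
    ultimately show ?thesis by (simp add: power_divide ac_simps)
  qed
  have nf: "norm (f n t) = frac_kernel a t * exp (- r * t) * ((norm w * \<bar>t\<bar>) ^ n /\<^sub>R fact n)" for n t
    using frac_kernel_nonneg[OF assms(1), of t]
    by (simp add: f_def norm_mult norm_power)
  have sm_norm: "(\<lambda>n. norm (f n t)) sums (frac_kernel a t * exp (- r * t) * exp (norm w * \<bar>t\<bar>))" for t
    unfolding nf by (intro sums_mult exp_converges)
  have ft: "(\<lambda>n. f n t) sums (of_real (frac_kernel a t) * exp (- s * of_real t))" for t
  proof -
    have "(\<lambda>n. f n t) sums (of_real (frac_kernel a t * exp (- r * t)) * exp (- w * of_real t))"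
      unfolding f_def by (intro sums_mult exp_converges)
    moreover have "complex_of_real (exp (- r * t)) = exp (- of_real r * of_real t)"
      using exp_of_real[of "- r * t", where 'a = complex] by simp
    moreover have "exp (- of_real r * of_real t) * exp (- w * of_real t) = exp (- s * of_real t)"
      by (simp add: w_def mult_exp_exp algebra_simps)
    ultimately show ?thesis by (simp only: of_real_mult mult.assoc)
  qed
  have "integral\<^sup>L lborel (\<lambda>t. norm (f n t)) = pochhammer a n * r powr (- a - real n) * (norm w ^ n / fact n)" for n
  proof -
    have "(\<lambda>t. norm (f n t)) = (\<lambda>t. t ^ n * (frac_kernel a t * exp (- r * t)) * (norm w ^ n / fact n))"
      unfolding nf by (auto simp: frac_kernel_def power_mult_distrib divide_simps fun_eq_iff)
    moreover have "has_bochner_integral lborel (\<lambda>t. t ^ n * (frac_kernel a t * exp (- r * t)) * (norm w ^ n / fact n))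
        (pochhammer a n * r powr (- a - real n) * (norm w ^ n / fact n))"
      by (intro has_bochner_integral_mult_left hb)
    ultimately show ?thesis by (simp only: has_bochner_integral_integral_eq)
  qed
  moreover have "summable (\<lambda>n. pochhammer a n * r powr (- a - real n) * (norm w ^ n / fact n))"
  proof -
    \<comment> \<open>At \<open>- norm w\<close> all terms of the binomial series are nonnegative.\<close>
    have "norm (of_real (- norm w) / of_real r :: complex) < 1" using wr r0 by (simp add: norm_divide)
    from gen_binomial_complex[OF this, of "- of_real a"]
    have "summable (\<lambda>n. (- of_real a gchoose n) * (of_real (- norm w) / of_real r :: complex) ^ n)"
      by (rule sums_summable)
    then have "summable (\<lambda>n. of_real (r powr (- a)) * ((- of_real a gchoose n) * (of_real (- norm w) / of_real r :: complex) ^ n))"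
      by (rule summable_mult)
    moreover have "of_real (r powr (- a)) * ((- of_real a gchoose n) * (of_real (- norm w) / of_real r :: complex) ^ n)
      = of_real (pochhammer a n * r powr (- a - real n) * (norm w ^ n / fact n))" for n
      unfolding coeff[of n "of_real (- norm w)", symmetric] by simp
    ultimately have "summable (\<lambda>n. complex_of_real (pochhammer a n * r powr (- a - real n) * (norm w ^ n / fact n)))"
      by (simp only:)
    from summable_Re[OF this] show ?thesis by (simp only: Re_complex_of_real)
  qed
  ultimately have sn: "summable (\<lambda>n. integral\<^sup>L lborel (\<lambda>t. norm (f n t)))" by simp
  have int: "\<And>n. integrable lborel (f n)" using hf by (auto simp: has_bochner_integral_iff)
  have ae: "AE t in lborel. summable (\<lambda>n. norm (f n t))" using sm_norm by (auto simp: summable_def)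
  have eq: "(\<lambda>t. \<Sum>n. f n t) = (\<lambda>t. of_real (frac_kernel a t) * exp (- s * of_real t))"
    using ft by (auto simp: sums_iff)
  have "(\<lambda>n. integral\<^sup>L lborel (f n)) sums (\<integral>t. of_real (frac_kernel a t) * exp (- s * of_real t) \<partial>lborel)"
    using sums_integral[OF int ae sn] unfolding eq .
  moreover have "integral\<^sup>L lborel (f n) = of_real (r powr (- a)) * ((- of_real a gchoose n) * (w / of_real r) ^ n)" for n
    using hf[of n] unfolding coeff by (simp add: has_bochner_integral_iff)
  moreover have "(\<lambda>n. of_real (r powr (- a)) * ((- of_real a gchoose n) * (w / of_real r) ^ n)) sums
     (of_real (r powr (- a)) * (1 + w / of_real r) powr (- of_real a))"
    using wr r0 by (intro sums_mult gen_binomial_complex) (auto simp: norm_divide)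
  ultimately have "(\<integral>t. of_real (frac_kernel a t) * exp (- s * of_real t) \<partial>lborel)
     = of_real (r powr (- a)) * (1 + w / of_real r) powr (- of_real a)"
    by (simp add: sums_unique2)
  also have "1 + w / of_real r = s / of_real r" using r0 by (simp add: w_def field_simps)
  also have "of_real (r powr (- a)) * (s / of_real r) powr (- of_real a) = s powr (- of_real a)"
  proof -
    have "s powr (- of_real a) = (of_real r * (s / of_real r)) powr (- of_real a)" using r0 by simp
    also have "\<dots> = of_real r powr (- of_real a) * (s / of_real r) powr (- of_real a)"
      using r0 s0 by (simp add: powr_def Ln_times_of_real exp_add[symmetric] algebra_simps del: times_divide_eq_right)
    also have "(of_real r :: complex) powr (- of_real a) = of_real (r powr (- a))"
      using r0 powr_of_real[of r "- a"] by simp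
    finally show ?thesis by simp
  qed
  finally show ?thesis
    using integrable_suminf[OF int ae sn] unfolding eq by (simp add: has_bochner_integral_iff)
qed

section \<open>Convolutions and the Laplace transform\<close>

lemma lborel_integral_shift:
  fixes f :: "real \<Rightarrow> 'a :: {banach, second_countable_topology}"
  shows "(\<integral>t. f (t - v) \<partial>lborel) = (\<integral>t. f t \<partial>lborel)"
    and "integrable lborel (\<lambda>t. f (t - v)) \<longleftrightarrow> integrable lborel f"
  using lborel_integral_real_affine[of 1 f "- v"] lborel_integrable_real_affine_iff[of 1 f "- v"] by simp_all

lemma lborel_integral_reflect:
  fixes f :: "real \<Rightarrow> 'a :: {banach, second_countable_topology}"
  shows "(\<integral>t. f (u - t) \<partial>lborel) = (\<integral>t. f t \<partial>lborel)"
    and "integrable lborel (\<lambda>t. f (u - t)) \<longleftrightarrow> integrable lborel f"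
  using lborel_integral_real_affine[of "-1" f u] lborel_integrable_real_affine_iff[of "-1" f u] by simp_all

lemma has_bochner_integral_convolution:
  fixes a b :: "real \<Rightarrow> 'a :: {real_normed_field, banach, second_countable_topology}"
  assumes a: "integrable lborel a" and b: "integrable lborel b"
  shows "has_bochner_integral lborel (\<lambda>t. \<integral>v. a v * b (t - v) \<partial>lborel)
    ((\<integral>t. a t \<partial>lborel) * (\<integral>t. b t \<partial>lborel))"
proof -
  have [measurable]: "a \<in> borel_measurable borel" "b \<in> borel_measurable borel"
    using a b by (auto dest: borel_measurable_integrable)
  have I: "integrable (lborel \<Otimes>\<^sub>M lborel) (\<lambda>(v, t). a v * b (t - v))"
  proof (rule lborel_pair.Fubini_integrable)
    have "(\<lambda>v. \<integral>t. norm (case (v, t) of (v, t) \<Rightarrow> a v * b (t - v)) \<partial>lborel)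
        = (\<lambda>v. norm (a v) * (\<integral>t. norm (b t) \<partial>lborel))"
      using lborel_integral_shift(1)[of "\<lambda>t. norm (b t)"] by (simp add: norm_mult)
    then show "integrable lborel (\<lambda>v. \<integral>t. norm (case (v, t) of (v, t) \<Rightarrow> a v * b (t - v)) \<partial>lborel)"
      using a by simp
    show "AE v in lborel. integrable lborel (\<lambda>t. case (v, t) of (v, t) \<Rightarrow> a v * b (t - v))"
      using b by (simp add: lborel_integral_shift(2))
  qed measurable
  have "(\<integral>t. (\<integral>v. a v * b (t - v) \<partial>lborel) \<partial>lborel) = (\<integral>v. (\<integral>t. a v * b (t - v) \<partial>lborel) \<partial>lborel)"
    using lborel_pair.Fubini_integral[of "\<lambda>v t. a v * b (t - v)"] I by simp
  also have "\<dots> = (\<integral>t. a t \<partial>lborel) * (\<integral>t. b t \<partial>lborel)"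
    using lborel_integral_shift(1)[of b] by simp
  finally show ?thesis
    using lborel_pair.integrable_snd[OF I] by (simp add: has_bochner_integral_iff)
qed

text \<open>
  The integral runs over the whole line, so for functions vanishing on \<open>t \<le> 0\<close> this is the usual
  one-sided transform, and on the imaginary axis it is the Fourier transform.
\<close>

definition laplace :: "(real \<Rightarrow> real) \<Rightarrow> complex \<Rightarrow> complex" where
  "laplace f s = (\<integral>t. of_real (f t) * exp (- s * of_real t) \<partial>lborel)"

lemma laplace_frac_integral:
  fixes s :: complex
  assumes "a > 0" and "Re s > 0"
    and "integrable lborel (\<lambda>t. of_real (f t) * exp (- s * of_real t))"
    and x: "\<And>t. x t = (\<integral>v. frac_kernel a v * f (t - v) \<partial>lborel)"
  shows "laplace x s = s powr (- of_real a) * laplace f s"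
proof -
  have "has_bochner_integral lborel (\<lambda>t. \<integral>v. (of_real (frac_kernel a v) * exp (- s * of_real v)) *
       (of_real (f (t - v)) * exp (- s * of_real (t - v))) \<partial>lborel)
     (s powr (- of_real a) * laplace f s)"
    using has_bochner_integral_convolution[OF _ assms(3)] laplace_frac_kernel[OF assms(1,2)]
    by (simp add: laplace_def has_bochner_integral_iff)
  moreover have "(\<integral>v. (of_real (frac_kernel a v) * exp (- s * of_real v)) *
       (of_real (f (t - v)) * exp (- s * of_real (t - v))) \<partial>lborel) = of_real (x t) * exp (- s * of_real t)" for t
  proof -
    have "(of_real (frac_kernel a v) * exp (- s * of_real v)) * (of_real (f (t - v)) * exp (- s * of_real (t - v)))
       = of_real (frac_kernel a v * f (t - v)) * exp (- s * of_real t)" for v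
    proof -
      have "exp (- s * of_real v) * exp (- s * of_real (t - v)) = exp (- s * of_real t)"
        by (simp add: mult_exp_exp algebra_simps)
      then show ?thesis by (metis (no_types, lifting) mult.assoc mult.left_commute of_real_mult)
    qed
    then show ?thesis by (simp add: x del: of_real_mult)
  qed
  ultimately show ?thesis by (simp add: laplace_def has_bochner_integral_iff)
qed

section \<open>From fractional integrals to Caputo derivatives\<close>

text \<open>
  Fractional integrals of orders \<open>1 - \<alpha>\<close> and \<open>\<alpha>\<close> compose to ordinary integration: after scaling to
  \<open>{0..1}\<close> the integral is \<open>Beta (1 - \<alpha>) \<alpha> = Gamma (1 - \<alpha>) * Gamma \<alpha>\<close>.
\<close>

lemma frac_kernel_complementary:
  assumes "0 < \<alpha>" "\<alpha> < 1" "t > 0"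
  shows "has_bochner_integral lborel (\<lambda>s. frac_kernel (1 - \<alpha>) s * frac_kernel \<alpha> (t - s)) 1"
proof -
  define F where "F s = indicator {0..1} s * (s powr (- \<alpha>) * (1 - s) powr (\<alpha> - 1))" for s :: real
  have pos: "Gamma \<alpha> > 0" "Gamma (1 - \<alpha>) > 0" using assms by auto
  have B: "Beta (1 - \<alpha>) \<alpha> = Gamma (1 - \<alpha>) * Gamma \<alpha>" by (simp add: Beta_def)
  have "((\<lambda>t. t powr ((1 - \<alpha>) - 1) * (1 - t) powr (\<alpha> - 1)) has_integral Beta (1 - \<alpha>) \<alpha>) {0..1}"
    using assms by (intro has_integral_Beta_real) auto
  then have "((\<lambda>t. t powr (- \<alpha>) * (1 - t) powr (\<alpha> - 1)) has_integral (Gamma (1 - \<alpha>) * Gamma \<alpha>)) {0..1}"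
    by (simp add: B)
  from nn_integral_has_integral_lebesgue[OF _ this]
  have "has_bochner_integral lborel F (Gamma (1 - \<alpha>) * Gamma \<alpha>)"
    unfolding F_def by (intro has_bochner_integral_nn_integral) (use pos in auto)
  then have "has_bochner_integral lborel (\<lambda>s. F (s / t)) (Gamma (1 - \<alpha>) * Gamma \<alpha> * t)"
    using lborel_has_bochner_integral_real_affine_iff[of "1 / t" F _ 0] assms
    by (simp add: mult.commute)
  then have "has_bochner_integral lborel (\<lambda>s. F (s / t) * (1 / (Gamma (1 - \<alpha>) * Gamma \<alpha> * t)))
     ((Gamma (1 - \<alpha>) * Gamma \<alpha> * t) * (1 / (Gamma (1 - \<alpha>) * Gamma \<alpha> * t)))"
    by (intro has_bochner_integral_mult_left) auto
  moreover have "(Gamma (1 - \<alpha>) * Gamma \<alpha> * t) * (1 / (Gamma (1 - \<alpha>) * Gamma \<alpha> * t)) = 1"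
    using pos less_imp_neq[OF pos(1)] less_imp_neq[OF pos(2)] assms by simp
  moreover have "F (s / t) * (1 / (Gamma (1 - \<alpha>) * Gamma \<alpha> * t)) = frac_kernel (1 - \<alpha>) s * frac_kernel \<alpha> (t - s)" for s
  proof (cases "0 < s \<and> s < t")
    case True
    have "1 - s / t = (t - s) / t" using assms by (simp add: field_simps)
    then have "(s / t) powr (- \<alpha>) * (1 - s / t) powr (\<alpha> - 1)
       = s powr (- \<alpha>) * (t - s) powr (\<alpha> - 1) * (t powr \<alpha> * t powr (1 - \<alpha>))"
      using True assms by (simp add: powr_divide powr_minus powr_diff field_simps)
    also have "t powr \<alpha> * t powr (1 - \<alpha>) = t" using assms by (simp add: powr_add[symmetric])
    finally show ?thesis using True assms
      by (simp add: F_def frac_kernel_def indicator_def)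
  next
    case False
    then show ?thesis using assms
      by (cases "s = 0"; cases "s = t") (auto simp: F_def frac_kernel_def indicator_def field_simps)
  qed
  ultimately show ?thesis by simp
qed

text \<open>
  The passage from the integral equation back to the differential equation. The expression under the
  derivative in the Caputo definition is, by the preceding lemma and Fubini, simply the integral of
  \<open>f\<close> from \<open>0\<close> to \<open>u\<close>, so the fundamental theorem of calculus applies at every \<open>t > 0\<close>.
\<close>

lemma caputo_derivative_frac_integral:
  assumes \<alpha>: "0 < \<alpha>" "\<alpha> < 1" and f: "continuous_on UNIV f" and f0: "\<And>t. t \<le> 0 \<Longrightarrow> f t = 0"
    and z: "\<And>t. t \<ge> 0 \<Longrightarrow> z t = (\<integral>v. frac_kernel \<alpha> v * f (t - v) \<partial>lborel)"
    and t: "t > 0"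
  shows "has_caputo_derivative \<alpha> z (f t) t"
proof -
  define x where "x t = (\<integral>v. frac_kernel \<alpha> v * f (t - v) \<partial>lborel)" for t
  have x0: "x t = 0" if "t \<le> 0" for t
  proof -
    have "(\<lambda>v. frac_kernel \<alpha> v * f (t - v)) = (\<lambda>v. 0)"
      using f0[of "t - v" for v] that by (auto simp: frac_kernel_def)
    then show ?thesis by (simp add: x_def)
  qed
  have [measurable]: "f \<in> borel_measurable borel" using f by (rule borel_measurable_continuous_onI)
  have key: "1 / Gamma (1 - \<alpha>) * integral {0..u} (\<lambda>s. (u - s) powr (- \<alpha>) * (z s - z 0)) = integral {0..u} f"
    if u: "u > 0" for u
  proof -
    have fi: "set_integrable lborel {0..u} f"
      by (intro borel_integrable_atLeastAtMost') (use f continuous_on_subset in blast)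
    have fu: "indicator {0..u} s *\<^sub>R f s = (if u - s > 0 then f s else 0)" if "s \<noteq> u" for s
      using f0[of s] that by (auto simp: indicator_def)
    have "integrable lborel (\<lambda>s. if u - s > 0 then f s else 0)"
      using fi unfolding set_integrable_def
    proof (rule integrable_cong_AE_imp)
      show "AE s in lborel. indicator {0..u} s *\<^sub>R f s = (if u - s > 0 then f s else 0)"
        using AE_lborel_singleton[of u] by eventually_elim (rule fu)
    qed measurable
    then have fw: "integrable lborel (\<lambda>w. if w > 0 then f (u - w) else 0)"
      using lborel_integral_reflect(2)[of "\<lambda>s. if u - s > 0 then f s else 0" u] by simp
    have "(\<integral>w. (if w > 0 then f (u - w) else 0) \<partial>lborel) = (\<integral>s. (if u - s > 0 then f s else 0) \<partial>lborel)"
      using lborel_integral_reflect(1)[of "\<lambda>s. if u - s > 0 then f s else 0" u] by simp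
    also have "\<dots> = (\<integral>s. indicator {0..u} s *\<^sub>R f s \<partial>lborel)"
    proof (rule integral_cong_AE)
      show "AE s in lborel. (if u - s > 0 then f s else 0) = indicator {0..u} s *\<^sub>R f s"
        using AE_lborel_singleton[of u] by eventually_elim (rule fu[symmetric])
    qed measurable
    also have "\<dots> = integral {0..u} f"
      using set_borel_integral_eq_integral(2)[OF fi] by (simp add: set_lebesgue_integral_def)
    finally have fint: "(\<integral>w. (if w > 0 then f (u - w) else 0) \<partial>lborel) = integral {0..u} f" .

    \<comment> \<open>Integrating \<open>\<Phi>\<close> over \<open>v\<close> first gives \<open>f\<close>, over \<open>w\<close> first the double fractional integral.\<close>
    define \<Phi> where "\<Phi> w v = frac_kernel (1 - \<alpha>) v * frac_kernel \<alpha> (w - v) * f (u - w)" for w v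
    have [measurable]: "(\<lambda>(w, v). \<Phi> w v) \<in> borel_measurable (lborel \<Otimes>\<^sub>M lborel)"
      unfolding \<Phi>_def by measurable
    have inner: "has_bochner_integral lborel (\<lambda>v. frac_kernel (1 - \<alpha>) v * frac_kernel \<alpha> (w - v)) (if w > 0 then 1 else 0)" for w
    proof (cases "w > 0")
      case False
      then have "(\<lambda>v. frac_kernel (1 - \<alpha>) v * frac_kernel \<alpha> (w - v)) = (\<lambda>v. 0)"
        by (auto simp: frac_kernel_def)
      then show ?thesis using False by (simp add: has_bochner_integral_zero)
    qed (use frac_kernel_complementary \<alpha> in auto)
    have I: "integrable (lborel \<Otimes>\<^sub>M lborel) (\<lambda>(w, v). \<Phi> w v)"
    proof (rule lborel_pair.Fubini_integrable)
      have "norm (case (w, v) of (w, v) \<Rightarrow> \<Phi> w v) = frac_kernel (1 - \<alpha>) v * frac_kernel \<alpha> (w - v) * \<bar>f (u - w)\<bar>" for w v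
        using \<alpha> by (simp add: \<Phi>_def abs_mult frac_kernel_nonneg)
      then have "(\<integral>v. norm (case (w, v) of (w, v) \<Rightarrow> \<Phi> w v) \<partial>lborel) = norm (if w > 0 then f (u - w) else 0)" for w
        using inner[of w] by (simp add: has_bochner_integral_iff)
      then show "integrable lborel (\<lambda>w. \<integral>v. norm (case (w, v) of (w, v) \<Rightarrow> \<Phi> w v) \<partial>lborel)"
        using integrable_norm[OF fw] by simp
      show "AE w in lborel. integrable lborel (\<lambda>v. case (w, v) of (w, v) \<Rightarrow> \<Phi> w v)"
        using inner by (auto simp: \<Phi>_def has_bochner_integral_iff)
    qed measurable
    have w1: "(\<integral>w. \<Phi> w v \<partial>lborel) = frac_kernel (1 - \<alpha>) v * x (u - v)" for v
    proof -
      have "(\<integral>w. \<Phi> w v \<partial>lborel) = (\<integral>w. frac_kernel (1 - \<alpha>) v * (frac_kernel \<alpha> (w - v) * f (u - v - (w - v))) \<partial>lborel)"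
        by (simp add: \<Phi>_def mult.assoc)
      also have "\<dots> = (\<integral>w. frac_kernel (1 - \<alpha>) v * (frac_kernel \<alpha> w * f (u - v - w)) \<partial>lborel)"
        by (rule lborel_integral_shift(1))
      finally show ?thesis by (simp add: x_def)
    qed
    have v1: "(\<integral>v. \<Phi> w v \<partial>lborel) = (if w > 0 then f (u - w) else 0)" for w
      using inner[of w] by (simp add: \<Phi>_def has_bochner_integral_iff)
    have "(\<integral>v. frac_kernel (1 - \<alpha>) v * x (u - v) \<partial>lborel) = integral {0..u} f"
      using lborel_pair.Fubini_integral[OF I] by (simp add: w1 v1 fint)
    moreover have "integrable lborel (\<lambda>v. frac_kernel (1 - \<alpha>) v * x (u - v))"
      using lborel_pair.integrable_snd[OF I] by (simp add: w1)
    ultimately have "has_bochner_integral lborel (\<lambda>v. frac_kernel (1 - \<alpha>) v * x (u - v)) (integral {0..u} f)"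
      by (simp add: has_bochner_integral_iff)
    then have h: "has_bochner_integral lborel (\<lambda>s. frac_kernel (1 - \<alpha>) (u - s) * x s) (integral {0..u} f)"
      using lborel_integral_reflect[of "\<lambda>v. frac_kernel (1 - \<alpha>) v * x (u - v)" u]
      by (simp add: has_bochner_integral_iff)
    have e: "frac_kernel (1 - \<alpha>) (u - s) * x s = indicator {0..u} s *\<^sub>R (1 / Gamma (1 - \<alpha>) * ((u - s) powr (- \<alpha>) * (z s - z 0)))" for s
      using x0[of s] x0[of 0] z[of s] z[of 0] u
      by (cases "s \<le> 0"; cases "s = u") (auto simp: frac_kernel_def indicator_def x_def)
    have "integral {0..u} (\<lambda>s. 1 / Gamma (1 - \<alpha>) * ((u - s) powr (- \<alpha>) * (z s - z 0))) = integral {0..u} f"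
      using h set_borel_integral_eq_integral(2)[of "{0..u}" "\<lambda>s. 1 / Gamma (1 - \<alpha>) * ((u - s) powr (- \<alpha>) * (z s - z 0))"]
      unfolding e by (simp add: set_integrable_def set_lebesgue_integral_def has_bochner_integral_iff)
    then show ?thesis by simp
  qed
  have "((\<lambda>u. integral {0..u} f) has_real_derivative f t) (at t within {0..t+1})"
    by (rule integral_has_real_derivative) (use f t continuous_on_subset in auto)
  then have "((\<lambda>u. integral {0..u} f) has_real_derivative f t) (at t)"
    using t by (subst (asm) at_within_interior) auto
  then show ?thesis
    unfolding has_caputo_derivative_def
    by (rule has_field_derivative_transform_within_open[of _ _ _ "{0<..}"]) (use key t in auto)
qed

section \<open>Volterra equations with delay\<close>

lemma continuous_convolution:
  fixes k w :: "real \<Rightarrow> real"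
  assumes k: "integrable lborel k" and w: "continuous_on UNIV w" and B: "\<And>t. \<bar>w t\<bar> \<le> B"
  shows "continuous_on UNIV (\<lambda>t. \<integral>s. k s * w (t - s) \<partial>lborel)"
    and "integrable lborel (\<lambda>s. k s * w (t - s))"
    and "\<bar>\<integral>s. k s * w (t - s) \<partial>lborel\<bar> \<le> B * (\<integral>s. \<bar>k s\<bar> \<partial>lborel)"
proof -
  have [measurable]: "k \<in> borel_measurable borel" "w \<in> borel_measurable borel"
    using k w by (auto dest: borel_measurable_integrable intro: borel_measurable_continuous_onI)
  have d: "integrable lborel (\<lambda>s. B * \<bar>k s\<bar>)" using k by simp
  have b: "norm (k s * w (t - s)) \<le> B * \<bar>k s\<bar>" for s t
    using mult_left_mono[OF B[of "t - s"], of "\<bar>k s\<bar>"] by (simp add: abs_mult mult.commute)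
  show "continuous_on UNIV (\<lambda>t. \<integral>s. k s * w (t - s) \<partial>lborel)"
    unfolding continuous_on_sequentially comp_def
  proof (intro allI ballI impI)
    fix X and t :: real
    assume X: "(\<forall>n. X n \<in> UNIV) \<and> X \<longlonglongrightarrow> t"
    show "(\<lambda>n. \<integral>s. k s * w (X n - s) \<partial>lborel) \<longlonglongrightarrow> (\<integral>s. k s * w (t - s) \<partial>lborel)"
    proof (rule integral_dominated_convergence[where w="\<lambda>s. B * \<bar>k s\<bar>", OF _ _ d])
      show "AE s in lborel. (\<lambda>n. k s * w (X n - s)) \<longlonglongrightarrow> k s * w (t - s)"
        using X by (intro AE_I2 tendsto_intros continuous_on_tendsto_compose[OF w]) auto
    qed (use b in auto)
  qed
  show i: "integrable lborel (\<lambda>s. k s * w (t - s))" for t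
  proof (rule Bochner_Integration.integrable_bound[OF d])
    show "AE s in lborel. norm (k s * w (t - s)) \<le> norm (B * \<bar>k s\<bar>)"
      by (rule AE_I2) (rule order_trans[OF b], simp)
  qed measurable
  show "\<bar>\<integral>s. k s * w (t - s) \<partial>lborel\<bar> \<le> B * (\<integral>s. \<bar>k s\<bar> \<partial>lborel)"
    using Bochner_Integration.integral_norm_bound_integral[OF i d b] by simp
qed

text \<open>
  The equation at times up to \<open>T\<close> involves \<open>v\<close> only at earlier times, so any bound on \<open>(-\<infinity>, T]\<close> can
  be halved again and again. This gives uniqueness up to a given time, hence both the gluing of
  solutions and their vanishing for negative times.
\<close>

lemma causal_contraction_vanishes:
  fixes k v :: "real \<Rightarrow> real"
  assumes k: "integrable lborel k" "\<And>s. k s \<ge> 0" "\<And>s. s \<le> 0 \<Longrightarrow> k s = 0"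
    and c: "\<bar>c\<bar> * (\<integral>s. k s \<partial>lborel) \<le> 1 / 2"
    and B: "\<And>t. t \<le> T \<Longrightarrow> \<bar>v t\<bar> \<le> B"
    and eq: "\<And>t. t \<le> T \<Longrightarrow> v t = (\<integral>s. k s * (c * v (t - s)) \<partial>lborel)"
    and "t \<le> T"
  shows "v t = 0"
proof -
  have "\<forall>t\<le>T. \<bar>v t\<bar> \<le> B / 2 ^ n" for n
  proof (induction n)
    case (Suc n)
    show ?case
    proof (intro allI impI)
      fix t assume t: "t \<le> T"
      have d: "integrable lborel (\<lambda>s. k s * (\<bar>c\<bar> * (B / 2 ^ n)))" using k by simp
      have b: "norm (k s * (c * v (t - s))) \<le> k s * (\<bar>c\<bar> * (B / 2 ^ n))" for s
      proof (cases "s \<le> 0")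
        case False
        then have "\<bar>v (t - s)\<bar> \<le> B / 2 ^ n" using Suc t by simp
        then have "\<bar>c\<bar> * \<bar>v (t - s)\<bar> \<le> \<bar>c\<bar> * (B / 2 ^ n)" by (rule mult_left_mono) simp
        from mult_left_mono[OF this k(2)[of s]] show ?thesis using k(2)[of s] by (simp add: abs_mult)
      qed (simp add: k)
      have B0: "B \<ge> 0" using B[OF t] by simp
      have "\<bar>v t\<bar> \<le> (\<integral>s. k s * (\<bar>c\<bar> * (B / 2 ^ n)) \<partial>lborel)"
      proof (cases "integrable lborel (\<lambda>s. k s * (c * v (t - s)))")
        case True
        then show ?thesis using Bochner_Integration.integral_norm_bound_integral[OF True d b] eq[OF t] by simp
      next
        case False
        then have "v t = 0" using eq[OF t] by (simp add: not_integrable_integral_eq)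
        then show ?thesis using k B0 by simp
      qed
      also have "\<dots> = (\<bar>c\<bar> * (\<integral>s. k s \<partial>lborel)) * (B / 2 ^ n)" by simp
      also have "\<dots> \<le> 1 / 2 * (B / 2 ^ n)" using c B0 by (intro mult_right_mono) auto
      finally show "\<bar>v t\<bar> \<le> B / 2 ^ Suc n" by simp
    qed
  qed (use B in auto)
  then have "\<bar>v t\<bar> \<le> B / 2 ^ n" for n using assms by blast
  moreover have "(\<lambda>n. B / 2 ^ n) \<longlonglongrightarrow> 0"
    using tendsto_mult[OF tendsto_const[of B] LIMSEQ_power_zero[of "1 / 2 :: real"]] by (simp add: power_divide)
  ultimately have "\<bar>v t\<bar> \<le> 0" by (intro LIMSEQ_le_const[of _ 0]) auto
  then show ?thesis by simp
qed

text \<open>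
  The state space for solutions: the kernel only sees the past, so for such functions every
  convolution with the kernel is an integral over a bounded time interval.
\<close>

definition started :: "(real \<Rightarrow> real) \<Rightarrow> bool" where
  "started y \<longleftrightarrow> continuous_on UNIV y \<and> (\<forall>t\<le>0. y t = 0)"

lemma started_bounded:
  assumes "started y"
  obtains B where "B \<ge> 0" "\<And>t. t \<le> T \<Longrightarrow> \<bar>y t\<bar> \<le> B"
proof -
  have "continuous_on {0..T} y" using assms continuous_on_subset by (auto simp: started_def)
  then have "bounded (y ` {0..T})" by (intro compact_imp_bounded compact_continuous_image) auto
  then obtain B where B: "B > 0" "\<And>t. t \<in> {0..T} \<Longrightarrow> norm (y t) \<le> B"
    unfolding bounded_pos by auto
  show ?thesis
  proof (rule that[of B])
    fix t assume "t \<le> T"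
    then show "\<bar>y t\<bar> \<le> B" using B assms by (cases "t \<le> 0") (auto simp: started_def)
  qed (use B in simp)
qed

text \<open>
  The exponential weight for which the fractional integral operator becomes a contraction.
\<close>

lemma exp_damping:
  fixes a c :: real
  assumes "a > 0" "c \<ge> 0"
  obtains M where "M > 0" "c * M powr (- a) \<le> 1 / 2"
proof (rule that)
  define M where "M = (2 * c + 1) powr (1 / a)"
  show "M > 0" using assms by (simp add: M_def)
  have "M powr (- a) = 1 / (2 * c + 1)" using assms by (simp add: M_def powr_powr powr_minus_divide)
  moreover have "c * (1 / (2 * c + 1)) \<le> 1 / 2" using assms by (simp add: divide_le_eq)
  ultimately show "c * M powr (- a) \<le> 1 / 2" by (simp only:)
qed

lemma frac_kernel_started_integrable:
  assumes "a > 0" "started y"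
  shows "integrable lborel (\<lambda>s. frac_kernel a s * y (t - s))"
proof -
  have [measurable]: "y \<in> borel_measurable borel"
    using assms by (auto simp: started_def intro: borel_measurable_continuous_onI)
  obtain B where B: "B \<ge> 0" "\<And>s. s \<le> t \<Longrightarrow> \<bar>y s\<bar> \<le> B" using started_bounded[OF assms(2)] by blast
  have "integrable lborel (\<lambda>s. frac_kernel a s * exp (- 1 * s))"
    using laplace_frac_kernel_real[OF assms(1), of 1] by (simp add: has_bochner_integral_iff)
  then have d: "integrable lborel (\<lambda>s. exp t * B * (frac_kernel a s * exp (- 1 * s)))" by simp
  show ?thesis
  proof (rule Bochner_Integration.integrable_bound[OF d])
    have "norm (frac_kernel a s * y (t - s)) \<le> norm (exp t * B * (frac_kernel a s * exp (- 1 * s)))" for s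
    proof (cases "0 < s \<and> s < t")
      case True
      then have "\<bar>y (t - s)\<bar> \<le> B" using B by simp
      also have "\<dots> \<le> exp (t - s) * B" using True B(1) by (simp add: mult_right_mono[of 1 "exp (t - s)" B, simplified])
      finally have "\<bar>y (t - s)\<bar> \<le> exp t * exp (- s) * B" by (simp add: exp_diff exp_minus divide_inverse)
      from mult_left_mono[OF this frac_kernel_nonneg[OF assms(1), of s]]
      show ?thesis using frac_kernel_nonneg[OF assms(1), of s] B(1) by (simp add: abs_mult mult.assoc mult.left_commute mult.commute)
    next
      case False
      then have "frac_kernel a s * y (t - s) = 0"
        using assms(2) by (auto simp: frac_kernel_def started_def)
      then have "norm (frac_kernel a s * y (t - s)) = 0" by (simp only: norm_zero)
      then show ?thesis by (metis norm_ge_zero)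
    qed
    then show "AE s in lborel. norm (frac_kernel a s * y (t - s)) \<le> norm (exp t * B * (frac_kernel a s * exp (- 1 * s)))"
      by simp
  qed measurable
qed

lemma volterra_unique:
  assumes "a > 0" "started d" and eq: "\<And>t. t \<le> T \<Longrightarrow> d t = (\<integral>s. frac_kernel a s * (c * d (t - s)) \<partial>lborel)"
    and "t \<le> T"
  shows "d t = 0"
proof -
  obtain M where M: "M > 0" "\<bar>c\<bar> * M powr (- a) \<le> 1 / 2" using exp_damping[OF assms(1), of "\<bar>c\<bar>"] by auto
  define k where "k s = frac_kernel a s * exp (- M * s)" for s
  have k: "has_bochner_integral lborel k (M powr (- a))"
    unfolding k_def by (rule laplace_frac_kernel_real) (use assms M in auto)
  define v where "v t = exp (- M * t) * d t" for t
  obtain B where B: "B \<ge> 0" "\<And>s. s \<le> T \<Longrightarrow> \<bar>d s\<bar> \<le> B" using started_bounded[OF assms(2)] by blast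
  have "v t = 0"
  proof (rule causal_contraction_vanishes[of k c T v B])
    show "\<bar>v t\<bar> \<le> B" if "t \<le> T" for t
    proof (cases "t \<le> 0")
      case True then show ?thesis using assms B by (simp add: v_def started_def)
    next
      case False
      then have "exp (- M * t) \<le> 1" using M by simp
      then have "exp (- M * t) * \<bar>d t\<bar> \<le> 1 * B" using B that by (intro mult_mono) auto
      then show ?thesis by (simp add: v_def abs_mult)
    qed
    show "v t = (\<integral>s. k s * (c * v (t - s)) \<partial>lborel)" if "t \<le> T" for t
    proof -
      have e: "exp (- M * s) * exp (- M * (t - s)) = exp (- M * t)" for s
        by (simp add: mult_exp_exp algebra_simps)
      have "k s * (c * v (t - s)) = exp (- M * t) * (frac_kernel a s * (c * d (t - s)))" for s
        unfolding k_def v_def e[of s, symmetric] by (simp only: ac_simps)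
      then have "(\<lambda>s. k s * (c * v (t - s))) = (\<lambda>s. exp (- M * t) * (frac_kernel a s * (c * d (t - s))))" by (rule ext)
      then show ?thesis using eq[OF that] by (simp add: v_def)
    qed
    show "k s \<ge> 0" for s using assms by (simp add: k_def frac_kernel_nonneg)
    show "k s = 0" if "s \<le> 0" for s using that by (simp add: k_def frac_kernel_def)
  qed (use k M assms in \<open>auto simp: has_bochner_integral_iff\<close>)
  then show ?thesis by (simp add: v_def)
qed

text \<open>
  Banach's fixed point theorem for \<open>v t = exp (- M t) x t\<close> among all bounded continuous functions on
  the line. That the fixed point vanishes for \<open>t \<le> 0\<close> is not built into the space; it follows from
  causality.
\<close>

lemma volterra_linear_solution:
  assumes a: "a > 0" and h: "started h" and B: "\<And>t. \<bar>h t\<bar> \<le> B"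
  obtains x where "started x" "\<And>t. x t = (\<integral>s. frac_kernel a s * (c * x (t - s) + h (t - s)) \<partial>lborel)"
proof -
  obtain M where M: "M > 0" "\<bar>c\<bar> * M powr (- a) \<le> 1 / 2" using exp_damping[OF a, of "\<bar>c\<bar>"] by auto
  define k where "k s = frac_kernel a s * exp (- M * s)" for s
  have hk: "has_bochner_integral lborel k (M powr (- a))"
    unfolding k_def by (rule laplace_frac_kernel_real) (use assms M in auto)
  have k12: "integrable lborel k" "(\<integral>s. k s \<partial>lborel) = M powr (- a)"
    using hk by (auto simp: has_bochner_integral_iff)
  have k3: "k s \<ge> 0" for s using a by (simp add: k_def frac_kernel_nonneg)
  have k4: "k s = 0" if "s \<le> 0" for s using that by (simp add: k_def frac_kernel_def)
  note k = k12 k3 k4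
  define hM where "hM t = exp (- M * t) * h t" for t
  have hMB: "\<bar>hM t\<bar> \<le> B" for t
  proof (cases "t \<le> 0")
    case True then show ?thesis using h B[of t] by (simp add: hM_def started_def)
  next
    case False
    then have "exp (- M * t) \<le> 1" using M by simp
    then have "exp (- M * t) * \<bar>h t\<bar> \<le> 1 * B" using B by (intro mult_mono) auto
    then show ?thesis by (simp add: hM_def abs_mult)
  qed
  have hMc: "continuous_on UNIV hM" unfolding hM_def using h by (auto simp: started_def intro!: continuous_intros)
  define \<Phi> where "\<Phi> v t = (\<integral>s. k s * (c * v (t - s) + hM (t - s)) \<partial>lborel)" for v :: "real \<Rightarrow> real" and t
  have bd: "\<exists>C. \<forall>t. \<bar>c * apply_bcontfun v t + hM t\<bar> \<le> C" for v :: "real \<Rightarrow>\<^sub>C real"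
  proof -
    obtain D where D: "\<And>t. norm (apply_bcontfun v t) \<le> D"
      using bounded_apply_bcontfun[of v] unfolding bounded_iff by blast
    have "\<bar>c * apply_bcontfun v t + hM t\<bar> \<le> \<bar>c\<bar> * D + B" for t
    proof -
      have "\<bar>c * apply_bcontfun v t + hM t\<bar> \<le> \<bar>c\<bar> * \<bar>apply_bcontfun v t\<bar> + \<bar>hM t\<bar>"
        by (metis abs_mult abs_triangle_ineq)
      also have "\<dots> \<le> \<bar>c\<bar> * D + B" using D[of t] hMB[of t] by (intro add_mono mult_left_mono) auto
      finally show ?thesis .
    qed
    then show ?thesis by blast
  qed
  have cw: "continuous_on UNIV (\<lambda>t. c * apply_bcontfun v t + hM t)" for v :: "real \<Rightarrow>\<^sub>C real"
    by (intro continuous_intros hMc continuous_on_apply_bcontfun)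
  have \<Phi>b: "\<Phi> (apply_bcontfun v) \<in> bcontfun" for v :: "real \<Rightarrow>\<^sub>C real"
  proof -
    obtain C where C: "\<And>t. \<bar>c * apply_bcontfun v t + hM t\<bar> \<le> C" using bd by blast
    show ?thesis
      unfolding bcontfun_def \<Phi>_def bounded_iff
      using continuous_convolution(1,3)[OF k(1) cw C] by auto
  qed
  define \<Psi> where "\<Psi> v = Bcontfun (\<Phi> (apply_bcontfun v))" for v :: "real \<Rightarrow>\<^sub>C real"
  have \<Psi>: "apply_bcontfun (\<Psi> v) = \<Phi> (apply_bcontfun v)" for v
    unfolding \<Psi>_def using \<Phi>b by (rule Bcontfun_inverse)
  have int: "integrable lborel (\<lambda>s. k s * (c * apply_bcontfun v (t - s) + hM (t - s)))" for v :: "real \<Rightarrow>\<^sub>C real" and t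
  proof -
    obtain C where C: "\<And>t. \<bar>c * apply_bcontfun v t + hM t\<bar> \<le> C" using bd by blast
    show ?thesis by (rule continuous_convolution(2)[OF k(1) cw C])
  qed
  have "\<exists>!v. \<Psi> v = v"
  proof (rule banach_fix_type)
    show "\<forall>v w. dist (\<Psi> v) (\<Psi> w) \<le> 1 / 2 * dist v w"
    proof (intro allI)
      fix v w
      show "dist (\<Psi> v) (\<Psi> w) \<le> 1 / 2 * dist v w"
      proof (rule dist_bound)
        fix t
        have b: "norm (k s * (c * apply_bcontfun v (t - s) + hM (t - s)) - k s * (c * apply_bcontfun w (t - s) + hM (t - s)))
          \<le> k s * (\<bar>c\<bar> * dist v w)" for s
        proof -
          have "k s * (c * apply_bcontfun v (t - s) + hM (t - s)) - k s * (c * apply_bcontfun w (t - s) + hM (t - s))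
            = k s * (c * (apply_bcontfun v (t - s) - apply_bcontfun w (t - s)))" by (simp add: algebra_simps)
          moreover have "\<bar>apply_bcontfun v (t - s) - apply_bcontfun w (t - s)\<bar> \<le> dist v w"
            using dist_bounded[of v "t - s" w] by (simp add: dist_real_def)
          ultimately show ?thesis using k(3)[of s] by (auto simp: abs_mult intro!: mult_left_mono)
        qed
        have "dist (\<Psi> v t) (\<Psi> w t) = norm (\<integral>s. k s * (c * apply_bcontfun v (t - s) + hM (t - s))
            - k s * (c * apply_bcontfun w (t - s) + hM (t - s)) \<partial>lborel)"
          unfolding \<Psi> \<Phi>_def dist_norm using int by simp
        also have "\<dots> \<le> (\<integral>s. k s * (\<bar>c\<bar> * dist v w) \<partial>lborel)"
          by (rule Bochner_Integration.integral_norm_bound_integral[OF _ _ b]) (use int k in simp_all)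
        also have "\<dots> = (\<bar>c\<bar> * M powr (- a)) * dist v w" using k by simp
        also have "\<dots> \<le> 1 / 2 * dist v w" using M by (intro mult_right_mono) auto
        finally show "dist (\<Psi> v t) (\<Psi> w t) \<le> 1 / 2 * dist v w" .
      qed
    qed
  qed auto
  then obtain vv where "\<Psi> vv = vv" by blast
  define v where "v = apply_bcontfun vv"
  have veq: "v t = (\<integral>s. k s * (c * v (t - s) + hM (t - s)) \<partial>lborel)" for t
    using fun_cong[OF \<Psi>[of vv], of t] \<open>\<Psi> vv = vv\<close> by (simp add: v_def \<Phi>_def)
  obtain D where D: "\<And>t. \<bar>v t\<bar> \<le> D"
    using bounded_apply_bcontfun[of vv] unfolding bounded_iff v_def by auto
  have v0: "v t = 0" if "t \<le> 0" for t
  proof (rule causal_contraction_vanishes[of k c 0 v D])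
    show "v t = (\<integral>s. k s * (c * v (t - s)) \<partial>lborel)" if "t \<le> 0" for t
    proof -
      have "k s * (c * v (t - s) + hM (t - s)) = k s * (c * v (t - s))" for s
        using k(4)[of s] h that by (cases "s \<le> 0") (auto simp: hM_def started_def)
      then have "(\<lambda>s. k s * (c * v (t - s) + hM (t - s))) = (\<lambda>s. k s * (c * v (t - s)))" by (rule ext)
      then show ?thesis using veq[of t] by (simp only:)
    qed
  qed (use k M D that in auto)
  define x where "x t = exp (M * t) * v t" for t
  show ?thesis
  proof (rule that)
    show "started x"
      unfolding started_def x_def v_def using v0 by (auto simp: v_def intro!: continuous_intros)
    show "x t = (\<integral>s. frac_kernel a s * (c * x (t - s) + h (t - s)) \<partial>lborel)" for t
    proof -
      have "frac_kernel a s * (c * x (t - s) + h (t - s)) = exp (M * t) * (k s * (c * v (t - s) + hM (t - s)))" for s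
      proof -
        have "exp (M * t) * exp (- M * s) = exp (M * (t - s))" "exp (M * (t - s)) * exp (- M * (t - s)) = 1"
          by (simp_all add: mult_exp_exp algebra_simps)
        moreover have "exp (M * t) * (k s * (c * v (t - s) + hM (t - s)))
          = frac_kernel a s * ((exp (M * t) * exp (- M * s)) * c * v (t - s)
             + (exp (M * t) * exp (- M * s)) * exp (- M * (t - s)) * h (t - s))"
          by (simp add: k_def hM_def algebra_simps)
        ultimately show ?thesis by (simp add: x_def algebra_simps)
      qed
      then show ?thesis using veq[of t] by (simp add: x_def)
    qed
  qed
qed

text \<open>
  The method of steps. The term \<open>\<Psi> x\<close> at time \<open>t\<close> depends on \<open>x\<close> only up to time \<open>t - \<tau>\<close>, so once \<open>x\<close>
  is known up to \<open>n \<tau>\<close>, the equation up to \<open>(n + 1) \<tau>\<close> is linear with a known inhomogeneity.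
  The solutions obtained for successive \<open>n\<close> agree where both satisfy the equation and are glued.
\<close>

lemma volterra_delay_solution:
  fixes \<Psi> :: "(real \<Rightarrow> real) \<Rightarrow> real \<Rightarrow> real"
  assumes a: "a > 0" and \<tau>: "\<tau> > 0"
    and start: "\<And>y. started y \<Longrightarrow> started (\<Psi> y)"
    and causal: "\<And>y y' T t. (\<And>t. t \<le> T \<Longrightarrow> y t = y' t) \<Longrightarrow> t \<le> T + \<tau> \<Longrightarrow> \<Psi> y t = \<Psi> y' t"
  shows "\<exists>x. started x \<and> (\<forall>t. x t = (\<integral>s. frac_kernel a s * (c * x (t - s) + \<Psi> x (t - s)) \<partial>lborel))"
proof -
  define P where "P n x \<longleftrightarrow> started x \<and>
     (\<forall>t \<le> real n * \<tau>. x t = (\<integral>s. frac_kernel a s * (c * x (t - s) + \<Psi> x (t - s)) \<partial>lborel))" for n x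
  define Q where "Q n x y \<longleftrightarrow> (\<forall>t \<le> real n * \<tau>. y t = x t)" for n and x y :: "real \<Rightarrow> real"
  have cong: "(\<integral>s. frac_kernel a s * f (t - s) \<partial>lborel) = (\<integral>s. frac_kernel a s * f' (t - s) \<partial>lborel)"
    if "\<And>r. r \<le> t \<Longrightarrow> f r = f' r" for f f' :: "real \<Rightarrow> real" and t
    by (intro Bochner_Integration.integral_cong) (use that in \<open>auto simp: frac_kernel_def\<close>)
  have st0: "started (\<lambda>_. 0)" by (simp add: started_def)
  have comb: "started (\<lambda>t. c * y t + z t)" if "started y" "started z" for y z
    using that by (auto simp: started_def intro!: continuous_intros)
  have "\<exists>X. \<forall>n. P n (X n) \<and> Q n (X n) (X (Suc n))"
  proof (rule dependent_nat_choice)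
    have "(\<integral>s. frac_kernel a s * (c * 0 + \<Psi> (\<lambda>_. 0) (t - s)) \<partial>lborel) = (\<integral>s. frac_kernel a s * 0 \<partial>lborel)" if "t \<le> 0" for t
      using cong[of t "\<lambda>r. c * 0 + \<Psi> (\<lambda>_. 0) r" "\<lambda>_. 0"] start[OF st0] that by (simp add: started_def)
    then have "P 0 (\<lambda>_. 0)" using st0 by (auto simp: P_def)
    then show "\<exists>x. P 0 x" by blast
  next
    fix x n assume Px: "P n x"
    then have sx: "started x" by (simp add: P_def)
    define T where "T = real (Suc n) * \<tau>"
    have T0: "T > 0" using \<tau> by (simp add: T_def)
    \<comment> \<open>Freezing the inhomogeneity at time \<open>T\<close> makes it bounded without changing it before \<open>T\<close>.\<close>
    define h where "h t = \<Psi> x (min t T)" for t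
    have s\<Psi>: "started (\<Psi> x)" by (rule start[OF sx])
    have "continuous_on UNIV (\<lambda>t. min t T)" by (intro continuous_intros)
    then have sh: "started h" unfolding h_def started_def
      using continuous_on_compose2[of UNIV "\<Psi> x" UNIV "\<lambda>t. min t T"] s\<Psi> by (auto simp: started_def)
    obtain B where B: "\<And>t. t \<le> T \<Longrightarrow> \<bar>\<Psi> x t\<bar> \<le> B" using started_bounded[OF s\<Psi>] by blast
    have hB: "\<bar>h t\<bar> \<le> B" for t using B[of "min t T"] by (simp add: h_def)
    obtain y where y: "started y" "\<And>t. y t = (\<integral>s. frac_kernel a s * (c * y (t - s) + h (t - s)) \<partial>lborel)"
      using volterra_linear_solution[OF a sh hB, of c] by blast
    have yeq: "y t = (\<integral>s. frac_kernel a s * (c * y (t - s) + \<Psi> x (t - s)) \<partial>lborel)" if "t \<le> T" for t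
      unfolding y(2)[of t] by (rule cong[of t "\<lambda>r. c * y r + h r" "\<lambda>r. c * y r + \<Psi> x r"]) (use that in \<open>auto simp: h_def\<close>)
    have nT: "real n * \<tau> \<le> T" using \<tau> by (simp add: T_def)
    have agree: "y t = x t" if "t \<le> real n * \<tau>" for t
    proof -
      have "y t - x t = 0"
      proof (rule volterra_unique[OF a, of "\<lambda>t. y t - x t" "real n * \<tau>" c])
        show "started (\<lambda>t. y t - x t)" using y(1) sx by (auto simp: started_def intro!: continuous_intros)
        fix t assume t: "t \<le> real n * \<tau>"
        have "x t = (\<integral>s. frac_kernel a s * (c * x (t - s) + \<Psi> x (t - s)) \<partial>lborel)"
          using Px t by (simp add: P_def)
        moreover have "y t = (\<integral>s. frac_kernel a s * (c * y (t - s) + \<Psi> x (t - s)) \<partial>lborel)"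
          using yeq t nT by simp
        ultimately have "y t - x t = (\<integral>s. frac_kernel a s * (c * y (t - s) + \<Psi> x (t - s))
            - frac_kernel a s * (c * x (t - s) + \<Psi> x (t - s)) \<partial>lborel)"
          using frac_kernel_started_integrable[OF a comb[OF y(1) start[OF sx]], of t]
            frac_kernel_started_integrable[OF a comb[OF sx start[OF sx]], of t] by simp
        also have "\<dots> = (\<integral>s. frac_kernel a s * (c * (y (t - s) - x (t - s))) \<partial>lborel)"
          by (rule Bochner_Integration.integral_cong) (simp_all add: algebra_simps)
        finally show "y t - x t = (\<integral>s. frac_kernel a s * (c * (y (t - s) - x (t - s))) \<partial>lborel)" .
      qed (use that in auto)
      then show ?thesis by simp
    qed
    have "\<Psi> x r = \<Psi> y r" if "r \<le> T" for r
      by (rule causal[of "real n * \<tau>"]) (use agree that in \<open>auto simp: T_def algebra_simps\<close>)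
    then have "y t = (\<integral>s. frac_kernel a s * (c * y (t - s) + \<Psi> y (t - s)) \<partial>lborel)" if "t \<le> T" for t
      using yeq[OF that] cong[of t "\<lambda>r. c * y r + \<Psi> x r" "\<lambda>r. c * y r + \<Psi> y r"] that by simp
    then have "P (Suc n) y" using y(1) by (simp add: P_def T_def)
    then show "\<exists>y. P (Suc n) y \<and> Q n x y" using agree by (auto simp: Q_def)
  qed
  then obtain X where X: "\<And>n. P n (X n)" "\<And>n. Q n (X n) (X (Suc n))" by blast
  have step: "X m t = X n t" if "n \<le> m" "t \<le> real n * \<tau>" for n m t
    using that(1)
  proof (induction m rule: dec_induct)
    case (step m)
    have "real n * \<tau> \<le> real m * \<tau>" using step(1) \<tau> by simp
    then have "X (Suc m) t = X m t" using X(2)[of m] that(2) by (auto simp: Q_def)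
    then show ?case using step by simp
  qed simp
  define N where "N t = nat \<lceil>t / \<tau>\<rceil>" for t
  have N: "t \<le> real (N t) * \<tau>" for t
  proof -
    have "t / \<tau> \<le> real (N t)" unfolding N_def by linarith
    then show ?thesis using \<tau> by (simp add: field_simps)
  qed
  define x where "x t = X (N t) t" for t
  have xX: "x t = X n t" if "t \<le> real n * \<tau>" for t n
  proof (cases "n \<le> N t")
    case True then show ?thesis using step[OF True that] by (simp add: x_def)
  next
    case False then show ?thesis using step[of "N t" n t] N[of t] by (simp add: x_def)
  qed
  show ?thesis
  proof (intro exI conjI allI)
    have "isCont x t" for t
    proof -
      define n where "n = Suc (N t)"
      have "t < real n * \<tau>" using N[of t] \<tau> by (simp add: n_def algebra_simps)
      then have "eventually (\<lambda>r. r \<in> {..<real n * \<tau>}) (nhds t)" by (intro eventually_nhds_in_open) auto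
      then have "eventually (\<lambda>r. x r = X n r) (nhds t)" by eventually_elim (simp add: xX)
      moreover have "isCont (X n) t" using X(1)[of n] by (auto simp: P_def started_def continuous_on_eq_continuous_at)
      ultimately show ?thesis by (simp add: isCont_cong)
    qed
    then show "started x"
      using xX[of _ 0] X(1)[of 0] by (auto simp: started_def P_def continuous_on_eq_continuous_at)
    show "x t = (\<integral>s. frac_kernel a s * (c * x (t - s) + \<Psi> x (t - s)) \<partial>lborel)" for t
    proof -
      define n where "n = N t"
      have tn: "t \<le> real n * \<tau>" using N by (simp add: n_def)
      have "\<Psi> x r = \<Psi> (X n) r" if "r \<le> real n * \<tau>" for r
        by (rule causal[of "real n * \<tau>"]) (use xX that \<tau> in auto)
      then have "(\<integral>s. frac_kernel a s * (c * x (t - s) + \<Psi> x (t - s)) \<partial>lborel)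
         = (\<integral>s. frac_kernel a s * (c * X n (t - s) + \<Psi> (X n) (t - s)) \<partial>lborel)"
        using cong[of t "\<lambda>r. c * x r + \<Psi> x r" "\<lambda>r. c * X n r + \<Psi> (X n) r"] xX tn by simp
      also have "\<dots> = X n t" using X(1)[of n] tn by (simp add: P_def)
      finally show ?thesis using xX[OF tn] by simp
    qed
  qed
qed

section \<open>A Plancherel inequality\<close>

definition autocorrelation :: "(real \<Rightarrow> real) \<Rightarrow> real \<Rightarrow> real" where
  "autocorrelation u h = (\<integral>v. u v * u (v - h) \<partial>lborel)"

lemma autocorrelation_integrable:
  assumes "integrable lborel u"
  shows "integrable lborel (autocorrelation u)"
proof -
  have "integrable lborel (\<lambda>w. u (- w))"
    using lborel_integral_reflect(2)[of u 0] assms by simp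
  from has_bochner_integral_convolution[OF assms this]
  show ?thesis by (simp add: autocorrelation_def[abs_def] has_bochner_integral_iff)
qed

text \<open>
  The autocorrelation is the convolution of \<open>u\<close> with its reflection, whose Fourier transform is the
  complex conjugate of that of \<open>u\<close>.
\<close>

lemma laplace_autocorrelation:
  assumes "integrable lborel u"
  shows "laplace (autocorrelation u) (\<i> * of_real b) = of_real ((norm (laplace u (\<i> * of_real b)))\<^sup>2)"
proof -
  define E where "E t = exp (- (\<i> * of_real b) * of_real t)" for t :: real
  have [measurable]: "E \<in> borel_measurable borel" unfolding E_def by measurable
  have nE: "norm (E t) = 1" for t by (simp add: E_def)
  have um[measurable]: "u \<in> borel_measurable borel" using assms by (auto dest: borel_measurable_integrable)
  have i1: "integrable lborel (\<lambda>t. of_real (u t) * E t)"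
    by (rule Bochner_Integration.integrable_bound[OF assms]) (auto simp: norm_mult nE)
  have ur: "integrable lborel (\<lambda>w. u (- w))"
    using lborel_integral_reflect(2)[of u 0] assms by simp
  have i2: "integrable lborel (\<lambda>t. of_real (u (- t)) * E t)"
    by (rule Bochner_Integration.integrable_bound[OF ur]) (auto simp: norm_mult nE)
  have "has_bochner_integral lborel (\<lambda>t. \<integral>v. of_real (u v) * E v * (of_real (u (- (t - v))) * E (t - v)) \<partial>lborel)
     ((\<integral>t. of_real (u t) * E t \<partial>lborel) * (\<integral>t. of_real (u (- t)) * E t \<partial>lborel))"
    by (rule has_bochner_integral_convolution[OF i1 i2])
  moreover have "(\<integral>v. of_real (u v) * E v * (of_real (u (- (t - v))) * E (t - v)) \<partial>lborel)
     = of_real (autocorrelation u t) * E t" for t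
  proof -
    have "E v * E (t - v) = E t" for v
      by (simp add: E_def mult_exp_exp algebra_simps)
    then have "of_real (u v) * E v * (of_real (u (- (t - v))) * E (t - v)) = of_real (u v * u (v - t)) * E t" for v
      by (metis (no_types, lifting) minus_diff_eq mult.assoc mult.left_commute of_real_mult)
    then show ?thesis by (simp add: autocorrelation_def del: of_real_mult)
  qed
  moreover have "(\<integral>t. of_real (u (- t)) * E t \<partial>lborel) = cnj (\<integral>t. of_real (u t) * E t \<partial>lborel)"
  proof -
    have "(\<integral>t. of_real (u (- t)) * E t \<partial>lborel) = (\<integral>t. of_real (u t) * E (- t) \<partial>lborel)"
      using lborel_integral_reflect(1)[of "\<lambda>t. of_real (u t) * E (- t)" 0] by simp
    also have "\<dots> = (\<integral>t. cnj (of_real (u t) * E t) \<partial>lborel)"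
      by (simp add: E_def exp_cnj)
    also have "\<dots> = cnj (\<integral>t. of_real (u t) * E t \<partial>lborel)" by (rule Bochner_Integration.integral_cnj)
    finally show ?thesis .
  qed
  ultimately have "(\<integral>t. of_real (autocorrelation u t) * E t \<partial>lborel)
      = (\<integral>t. of_real (u t) * E t \<partial>lborel) * cnj (\<integral>t. of_real (u t) * E t \<partial>lborel)"
    by (simp add: has_bochner_integral_iff)
  then show ?thesis
    unfolding laplace_def E_def[symmetric] complex_norm_square .
qed

text \<open>
  Averaging a Fourier transform against the standard normal law moves the transform onto the law,
  whose characteristic function is again Gaussian. For small \<open>\<eta>\<close> the frequencies \<open>c / \<eta>\<close> spread over the
  whole line while the right-hand side concentrates at \<open>A 0\<close>.
\<close>

lemma integral_fourier_std_normal: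
  assumes A: "integrable lborel A" and "\<eta> > 0"
  shows "(\<integral>c. laplace A (\<i> * of_real (c / \<eta>)) \<partial>std_normal_distribution)
     = of_real (\<eta> * sqrt (2 * pi) * (\<integral>v. A (\<eta> * v) * std_normal_density v \<partial>lborel))"
proof -
  interpret N: prob_space std_normal_distribution by (rule prob_space_normal_density) simp
  interpret pair_sigma_finite std_normal_distribution lborel ..
  have [measurable]: "A \<in> borel_measurable borel" using A by (auto dest: borel_measurable_integrable)
  define k where "k c h = of_real (A h) * exp (- (\<i> * of_real (c / \<eta>)) * of_real h)" for c h :: real
  have nk: "norm (k c h) = \<bar>A h\<bar>" for c h by (simp add: k_def norm_mult)
  have km[measurable]: "(\<lambda>(c, h). k c h) \<in> borel_measurable (std_normal_distribution \<Otimes>\<^sub>M lborel)"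
    unfolding k_def by measurable
  have I: "integrable (std_normal_distribution \<Otimes>\<^sub>M lborel) (\<lambda>(c, h). k c h)"
  proof (rule Fubini_integrable)
    show "AE c in std_normal_distribution. integrable lborel (\<lambda>h. case (c, h) of (c, h) \<Rightarrow> k c h)"
    proof (rule AE_I2)
      fix c
      have "(\<lambda>h. k c h) \<in> borel_measurable lborel" unfolding k_def by measurable
      then show "integrable lborel (\<lambda>h. case (c, h) of (c, h) \<Rightarrow> k c h)"
        using A by (intro Bochner_Integration.integrable_bound[OF A]) (auto simp: nk)
    qed
  qed (auto simp: nk)
  have inner: "(\<integral>c. k c h \<partial>std_normal_distribution) = of_real (A h * exp (- ((h / \<eta>)\<^sup>2) / 2))" for h
  proof -
    have "k c h = of_real (A h) * iexp ((- h / \<eta>) * c)" for c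
      by (simp add: k_def algebra_simps)
    then have "(\<integral>c. k c h \<partial>std_normal_distribution) = of_real (A h) * char std_normal_distribution (- h / \<eta>)"
      by (simp add: char_def)
    then show ?thesis by (simp add: char_std_normal_distribution)
  qed
  have "(\<integral>c. laplace A (\<i> * of_real (c / \<eta>)) \<partial>std_normal_distribution) = (\<integral>c. (\<integral>h. k c h \<partial>lborel) \<partial>std_normal_distribution)"
    by (simp add: laplace_def k_def)
  also have "\<dots> = (\<integral>h. (\<integral>c. k c h \<partial>std_normal_distribution) \<partial>lborel)"
    using Fubini_integral[OF I] by simp
  also have "\<dots> = (\<integral>h. complex_of_real (A h * exp (- ((h / \<eta>)\<^sup>2) / 2)) \<partial>lborel)"
    by (simp only: inner)
  also have "(\<integral>h. complex_of_real (A h * exp (- ((h / \<eta>)\<^sup>2) / 2)) \<partial>lborel) = of_real (\<integral>h. A h * exp (- ((h / \<eta>)\<^sup>2) / 2) \<partial>lborel)"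
    by (rule integral_complex_of_real)
  also have "(\<integral>h. A h * exp (- ((h / \<eta>)\<^sup>2) / 2) \<partial>lborel) = \<eta> * (\<integral>v. A (\<eta> * v) * exp (- (v\<^sup>2) / 2) \<partial>lborel)"
    using lborel_integral_real_affine[of \<eta> "\<lambda>h. A h * exp (- ((h / \<eta>)\<^sup>2) / 2)" 0] assms by simp
  also have "(\<integral>v. A (\<eta> * v) * exp (- (v\<^sup>2) / 2) \<partial>lborel) = (\<integral>v. sqrt (2 * pi) * (A (\<eta> * v) * std_normal_density v) \<partial>lborel)"
    by (intro Bochner_Integration.integral_cong) (auto simp: normal_density_def)
  finally show ?thesis by (simp add: mult.assoc)
qed

lemma autocorrelation_le:
  assumes "integrable lborel u" and "integrable lborel (\<lambda>t. (u t)\<^sup>2)"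
  shows "\<bar>autocorrelation u h\<bar> \<le> (\<integral>t. (u t)\<^sup>2 \<partial>lborel)"
proof -
  have [measurable]: "u \<in> borel_measurable borel" using assms by (auto dest: borel_measurable_integrable)
  have i2: "integrable lborel (\<lambda>v. (u (v - h))\<^sup>2)"
    using assms(2) lborel_integral_shift(2)[of "\<lambda>t. (u t)\<^sup>2" h] by simp
  have am: "norm (u v * u (v - h)) \<le> ((u v)\<^sup>2 + (u (v - h))\<^sup>2) / 2" for v
    using sum_squares_bound[of "\<bar>u v\<bar>" "\<bar>u (v - h)\<bar>"] by (simp add: abs_mult)
  have d: "integrable lborel (\<lambda>v. ((u v)\<^sup>2 + (u (v - h))\<^sup>2) / 2)"
    using assms(2) i2 by simp
  have i: "integrable lborel (\<lambda>v. u v * u (v - h))"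
  proof (rule Bochner_Integration.integrable_bound[OF d])
    show "AE v in lborel. norm (u v * u (v - h)) \<le> norm (((u v)\<^sup>2 + (u (v - h))\<^sup>2) / 2)"
      by (rule AE_I2) (rule order_trans[OF am], simp)
  qed measurable
  have "\<bar>autocorrelation u h\<bar> \<le> (\<integral>v. ((u v)\<^sup>2 + (u (v - h))\<^sup>2) / 2 \<partial>lborel)"
    unfolding autocorrelation_def real_norm_def[symmetric]
    by (rule Bochner_Integration.integral_norm_bound_integral[OF i d]) (rule am)
  also have "\<dots> = (\<integral>t. (u t)\<^sup>2 \<partial>lborel)"
    using assms i2 lborel_integral_shift(1)[of "\<lambda>t. (u t)\<^sup>2" h] by simp
  finally show ?thesis .
qed

lemma autocorrelation_tendsto:
  assumes u: "integrable lborel u" and c: "continuous_on UNIV u" and B: "\<And>t. \<bar>u t\<bar> \<le> B" and X: "X \<longlonglongrightarrow> 0"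
  shows "(\<lambda>n. autocorrelation u (X n)) \<longlonglongrightarrow> (\<integral>t. (u t)\<^sup>2 \<partial>lborel)"
  unfolding autocorrelation_def
proof (rule integral_dominated_convergence[where w="\<lambda>v. \<bar>u v\<bar> * B"])
  have [measurable]: "u \<in> borel_measurable borel" using assms by (auto dest: borel_measurable_integrable)
  show "(\<lambda>t. (u t)\<^sup>2) \<in> borel_measurable lborel" "(\<lambda>v. u v * u (v - X n)) \<in> borel_measurable lborel" for n
    by measurable
  show "integrable lborel (\<lambda>v. \<bar>u v\<bar> * B)" using u by simp
  have "(\<lambda>n. u v * u (v - X n)) \<longlonglongrightarrow> u v * u (v - 0)" for v
    by (intro tendsto_intros continuous_on_tendsto_compose[OF c] X) auto
  then show "AE v in lborel. (\<lambda>n. u v * u (v - X n)) \<longlonglongrightarrow> (u v)\<^sup>2"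
    by (simp add: power2_eq_square)
  show "AE v in lborel. norm (u v * u (v - X n)) \<le> \<bar>u v\<bar> * B" for n
    using B by (auto simp: abs_mult intro!: mult_left_mono)
qed

lemma gaussian_mean_fourier_square:
  assumes u: "integrable lborel u" and "\<eta> > 0"
  shows "has_bochner_integral std_normal_distribution (\<lambda>c. (norm (laplace u (\<i> * of_real (c / \<eta>))))\<^sup>2)
     (\<eta> * sqrt (2 * pi) * (\<integral>v. autocorrelation u (\<eta> * v) * std_normal_density v \<partial>lborel))"
proof -
  interpret N: prob_space std_normal_distribution by (rule prob_space_normal_density) simp
  have [measurable]: "u \<in> borel_measurable borel" using u by (auto dest: borel_measurable_integrable)
  have le: "norm (laplace u (\<i> * of_real b)) \<le> (\<integral>t. \<bar>u t\<bar> \<partial>lborel)" for b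
    unfolding laplace_def by (rule integral_norm_bound[THEN order_trans]) (simp add: norm_mult)
  have m: "(\<lambda>c. (norm (laplace u (\<i> * of_real (c / \<eta>))))\<^sup>2) \<in> borel_measurable borel"
    unfolding laplace_def by measurable
  have "integrable std_normal_distribution (\<lambda>c. (norm (laplace u (\<i> * of_real (c / \<eta>))))\<^sup>2)"
    by (rule N.integrable_const_bound[where B="(\<integral>t. \<bar>u t\<bar> \<partial>lborel)\<^sup>2"])
      (use m le[of "c / \<eta>" for c] in \<open>simp_all add: power_mono\<close>)
  moreover have "(\<integral>c. (norm (laplace u (\<i> * of_real (c / \<eta>))))\<^sup>2 \<partial>std_normal_distribution)
     = \<eta> * sqrt (2 * pi) * (\<integral>v. autocorrelation u (\<eta> * v) * std_normal_density v \<partial>lborel)"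
  proof -
    have "complex_of_real (\<integral>c. (norm (laplace u (\<i> * of_real (c / \<eta>))))\<^sup>2 \<partial>std_normal_distribution)
      = (\<integral>c. laplace (autocorrelation u) (\<i> * of_real (c / \<eta>)) \<partial>std_normal_distribution)"
      using laplace_autocorrelation[OF u, of "c / \<eta>" for c] by (subst integral_complex_of_real[symmetric]) simp
    then show ?thesis
      unfolding integral_fourier_std_normal[OF autocorrelation_integrable[OF u] assms(2)] of_real_eq_iff .
  qed
  ultimately show ?thesis by (simp add: has_bochner_integral_iff)
qed

text \<open>
  The part of Plancherel's theorem that the stability argument needs, without convergence of any
  Fourier integral: a pointwise estimate between squared transforms is averaged with Gaussian weights.
  Each weighted mean is a mean of autocorrelations, which is at most the full square integral and tends
  to it as \<open>\<eta>\<close> tends to \<open>0\<close> if the function is continuous and bounded; hence the assumptions on \<open>u\<close>.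
\<close>

lemma plancherel_domination:
  assumes u: "integrable lborel u" "continuous_on UNIV u" "\<And>t. \<bar>u t\<bar> \<le> B" "integrable lborel (\<lambda>t. (u t)\<^sup>2)"
    and p: "integrable lborel p" "integrable lborel (\<lambda>t. (p t)\<^sup>2)"
    and q: "integrable lborel q" "integrable lborel (\<lambda>t. (q t)\<^sup>2)"
    and "C \<ge> 0"
    and le: "\<And>b. (norm (laplace u (\<i> * of_real b)))\<^sup>2
       \<le> C * ((norm (laplace p (\<i> * of_real b)))\<^sup>2 + (norm (laplace q (\<i> * of_real b)))\<^sup>2)"
  shows "(\<integral>t. (u t)\<^sup>2 \<partial>lborel) \<le> C * ((\<integral>t. (p t)\<^sup>2 \<partial>lborel) + (\<integral>t. (q t)\<^sup>2 \<partial>lborel))"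
proof -
  define G where "G f \<eta> = (\<integral>v. autocorrelation f (\<eta> * v) * std_normal_density v \<partial>lborel)" for f \<eta>
  have am: "autocorrelation f \<in> borel_measurable borel" if "integrable lborel f" for f
    using autocorrelation_integrable[OF that] by (auto dest: borel_measurable_integrable)
  have dens: "integrable lborel std_normal_density" "(\<integral>v. std_normal_density v \<partial>lborel) = 1"
    by (auto simp: integrable_normal_density integral_normal_density)
  have up: "G f \<eta> \<le> (\<integral>t. (f t)\<^sup>2 \<partial>lborel)" if "integrable lborel f" "integrable lborel (\<lambda>t. (f t)\<^sup>2)" for f \<eta>
  proof -
    have [measurable]: "autocorrelation f \<in> borel_measurable borel" by (rule am) fact
    have a: "\<bar>autocorrelation f (\<eta> * v) * std_normal_density v\<bar> \<le> (\<integral>t. (f t)\<^sup>2 \<partial>lborel) * std_normal_density v" for v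
      using autocorrelation_le[OF that, of "\<eta> * v"] by (auto simp: abs_mult intro!: mult_right_mono)
    have d: "integrable lborel (\<lambda>v. (\<integral>t. (f t)\<^sup>2 \<partial>lborel) * std_normal_density v)" using dens by simp
    have i: "integrable lborel (\<lambda>v. autocorrelation f (\<eta> * v) * std_normal_density v)"
    proof (rule Bochner_Integration.integrable_bound[OF d])
      show "AE v in lborel. norm (autocorrelation f (\<eta> * v) * std_normal_density v)
          \<le> norm ((\<integral>t. (f t)\<^sup>2 \<partial>lborel) * std_normal_density v)"
        unfolding real_norm_def by (rule AE_I2) (rule order_trans[OF a abs_ge_self])
    qed measurable
    have "G f \<eta> \<le> (\<integral>v. (\<integral>t. (f t)\<^sup>2 \<partial>lborel) * std_normal_density v \<partial>lborel)"
      unfolding G_def by (rule integral_mono[OF i d]) (rule order_trans[OF abs_ge_self a])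
    then show ?thesis using dens by simp
  qed
  have step: "G u \<eta> \<le> C * ((\<integral>t. (p t)\<^sup>2 \<partial>lborel) + (\<integral>t. (q t)\<^sup>2 \<partial>lborel))" if \<eta>: "\<eta> > 0" for \<eta>
  proof -
    note hu = gaussian_mean_fourier_square[OF u(1) \<eta>, folded G_def]
    note hp = gaussian_mean_fourier_square[OF p(1) \<eta>, folded G_def]
    note hq = gaussian_mean_fourier_square[OF q(1) \<eta>, folded G_def]
    have "\<eta> * sqrt (2 * pi) * G u \<eta> \<le> C * (\<eta> * sqrt (2 * pi) * G p \<eta> + \<eta> * sqrt (2 * pi) * G q \<eta>)"
    proof -
      note hpq = has_bochner_integral_mult_right[OF has_bochner_integral_add[OF hp hq], of C]
      have "(\<integral>c. (norm (laplace u (\<i> * of_real (c / \<eta>))))\<^sup>2 \<partial>std_normal_distribution)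
        \<le> (\<integral>c. C * ((norm (laplace p (\<i> * of_real (c / \<eta>))))\<^sup>2 + (norm (laplace q (\<i> * of_real (c / \<eta>))))\<^sup>2) \<partial>std_normal_distribution)"
        by (rule integral_mono) (use hu hpq le in \<open>simp_all only: has_bochner_integral_iff\<close>)
      then show ?thesis
        unfolding has_bochner_integral_integral_eq[OF hu] has_bochner_integral_integral_eq[OF hpq] .
    qed
    also have "\<dots> = \<eta> * sqrt (2 * pi) * (C * (G p \<eta> + G q \<eta>))" by (simp add: algebra_simps)
    finally have "G u \<eta> \<le> C * (G p \<eta> + G q \<eta>)"
      by (rule mult_left_le_imp_le) (use \<eta> in simp)
    also have "\<dots> \<le> C * ((\<integral>t. (p t)\<^sup>2 \<partial>lborel) + (\<integral>t. (q t)\<^sup>2 \<partial>lborel))"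
      using \<open>C \<ge> 0\<close> up p q by (intro mult_left_mono add_mono) auto
    finally show ?thesis .
  qed
  have "(\<lambda>n. G u (inverse (real (Suc n)))) \<longlonglongrightarrow> (\<integral>v. (\<integral>t. (u t)\<^sup>2 \<partial>lborel) * std_normal_density v \<partial>lborel)"
    unfolding G_def
  proof (rule integral_dominated_convergence[where w="\<lambda>v. (\<integral>t. (u t)\<^sup>2 \<partial>lborel) * std_normal_density v"])
    have [measurable]: "autocorrelation u \<in> borel_measurable borel" by (rule am) fact
    show "(\<lambda>v. autocorrelation u (inverse (real (Suc n)) * v) * std_normal_density v) \<in> borel_measurable lborel" for n
      by measurable
    show "integrable lborel (\<lambda>v. (\<integral>t. (u t)\<^sup>2 \<partial>lborel) * std_normal_density v)" using dens by simp
    have "(\<lambda>n. inverse (real (Suc n)) * v) \<longlonglongrightarrow> 0 * v" for v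
      by (intro tendsto_intros LIMSEQ_inverse_real_of_nat)
    then show "AE v in lborel. (\<lambda>n. autocorrelation u (inverse (real (Suc n)) * v) * std_normal_density v)
        \<longlonglongrightarrow> (\<integral>t. (u t)\<^sup>2 \<partial>lborel) * std_normal_density v"
      by (intro AE_I2 tendsto_intros autocorrelation_tendsto[OF u(1-3)]) simp
    show "AE v in lborel. norm (autocorrelation u (inverse (real (Suc n)) * v) * std_normal_density v)
        \<le> (\<integral>t. (u t)\<^sup>2 \<partial>lborel) * std_normal_density v" for n
      using autocorrelation_le[OF u(1,4)] by (auto simp: abs_mult intro!: mult_right_mono)
  qed measurable
  then have "(\<lambda>n. G u (inverse (real (Suc n)))) \<longlonglongrightarrow> (\<integral>t. (u t)\<^sup>2 \<partial>lborel)" using dens by simp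
  then show ?thesis by (rule LIMSEQ_le_const2) (use step in auto)
qed

section \<open>Zeros of the characteristic function\<close>

lemma char_fun_of_real:
  assumes "x \<ge> 0"
  shows "char_fun \<alpha> \<gamma> \<tau>1 \<tau>2 k (of_real x) =
    of_real (x powr \<alpha> + \<gamma> - k * exp (- x * \<tau>1) + k * exp (- (x + \<gamma>) * \<tau>2 - x * \<tau>1))"
  unfolding char_fun_def using assms by (simp add: powr_of_real exp_of_real[symmetric] del: exp_of_real)

text \<open>
  On the positive axis the delay part \<open>k exp (- x \<tau>1) (1 - exp (- (x + \<gamma>) \<tau>2))\<close> is largest at
  \<open>x0 = ln (1 + \<tau>2 / \<tau>1) / \<tau>2 - \<gamma>\<close>, and \<open>k > k_star\<close> says exactly that the characteristic function is
  negative there. As \<open>x powr \<alpha>\<close> is unbounded, there is a root to the right of \<open>x0\<close>.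
\<close>

lemma char_fun_positive_root:
  assumes "\<gamma> < 0" and "0 < \<alpha>" and "\<tau>1 > 0" and "\<tau>2 > 0" and "k > 0" and ks: "k > k_star \<alpha> \<gamma> \<tau>1 \<tau>2"
  obtains x where "x > 0" "char_fun \<alpha> \<gamma> \<tau>1 \<tau>2 k (of_real x) = 0"
proof -
  define F where "F x = x powr \<alpha> + \<gamma> - k * exp (- x * \<tau>1) + k * exp (- (x + \<gamma>) * \<tau>2 - x * \<tau>1)" for x
  define L where "L = ln (1 + \<tau>2 / \<tau>1)"
  define x0 where "x0 = L / \<tau>2 - \<gamma>"
  have "1 + \<tau>2 / \<tau>1 > 1" using assms by simp
  then have "L > 0" unfolding L_def by (rule ln_gt_zero)
  then have "L / \<tau>2 > 0" using assms by simp
  then have x0: "x0 > 0" using assms unfolding x0_def by linarith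
  define A where "A = x0 powr \<alpha> + \<gamma>"
  define D where "D = exp (- x0 * \<tau>1) * (\<tau>2 / (\<tau>1 + \<tau>2))"
  define C where "C = (\<tau>1 + \<tau>2) powr (1 + \<tau>1 / \<tau>2) / (\<tau>2 * exp (\<gamma> * \<tau>1) * \<tau>1 powr (\<tau>1 / \<tau>2))"
  have D0: "D > 0" using assms by (simp add: D_def)
  have ratio: "1 + \<tau>2 / \<tau>1 = (\<tau>1 + \<tau>2) / \<tau>1" using assms by (simp add: field_simps)
  have L': "exp L = (\<tau>1 + \<tau>2) / \<tau>1" using assms by (simp add: L_def ratio)
  have e1: "exp (- (x0 + \<gamma>) * \<tau>2) = \<tau>1 / (\<tau>1 + \<tau>2)"
  proof -
    have "- (x0 + \<gamma>) * \<tau>2 = - L" using assms by (simp add: x0_def)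
    then show ?thesis by (simp add: exp_minus L')
  qed
  have e2: "exp (- x0 * \<tau>1) = exp (\<gamma> * \<tau>1) * (\<tau>1 powr (\<tau>1 / \<tau>2) / (\<tau>1 + \<tau>2) powr (\<tau>1 / \<tau>2))"
  proof -
    have "- x0 * \<tau>1 = \<gamma> * \<tau>1 + - ((\<tau>1 / \<tau>2) * L)" using assms by (simp add: x0_def field_simps)
    then have "exp (- x0 * \<tau>1) = exp (\<gamma> * \<tau>1) * inverse (exp ((\<tau>1 / \<tau>2) * L))"
      by (simp only: exp_add exp_minus)
    also have "exp ((\<tau>1 / \<tau>2) * L) = ((\<tau>1 + \<tau>2) / \<tau>1) powr (\<tau>1 / \<tau>2)"
      using assms by (simp add: powr_def L_def ratio)
    also have "\<dots> = (\<tau>1 + \<tau>2) powr (\<tau>1 / \<tau>2) / \<tau>1 powr (\<tau>1 / \<tau>2)"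
      using assms by (simp add: powr_divide)
    finally show ?thesis by (simp add: divide_inverse mult.commute)
  qed
  have CD: "C * D = 1"
  proof -
    have p: "(\<tau>1 + \<tau>2) powr (1 + \<tau>1 / \<tau>2) = (\<tau>1 + \<tau>2) * (\<tau>1 + \<tau>2) powr (\<tau>1 / \<tau>2)"
      using assms by (simp add: powr_add)
    have "S * q / (t * g * p) * (g * (p / q) * (t / S)) = 1"
      if "S \<noteq> 0" "q \<noteq> 0" "t \<noteq> 0" "g \<noteq> 0" "p \<noteq> 0" for S q t g p :: real
      using that by simp
    then show ?thesis unfolding C_def D_def e2 p using assms by simp
  qed
  have "k > C * A" using ks unfolding k_star_def C_def A_def x0_def L_def by simp
  then have "k * D > C * A * D" using D0 by simp
  also have "C * A * D = A" using CD by (simp add: mult.commute mult.left_commute)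
  finally have kD: "A < k * D" .
  have "F x0 = A - k * D"
  proof -
    have "exp (- (x0 + \<gamma>) * \<tau>2 - x0 * \<tau>1) = exp (- x0 * \<tau>1) * (\<tau>1 / (\<tau>1 + \<tau>2))"
      unfolding e1[symmetric] mult_exp_exp by (simp add: algebra_simps)
    then have "F x0 = A - k * (exp (- x0 * \<tau>1) * (1 - \<tau>1 / (\<tau>1 + \<tau>2)))"
      by (simp add: F_def A_def algebra_simps)
    moreover have "1 - \<tau>1 / (\<tau>1 + \<tau>2) = \<tau>2 / (\<tau>1 + \<tau>2)" using assms by (simp add: field_simps)
    ultimately show ?thesis by (simp add: D_def)
  qed
  then have neg: "F x0 \<le> 0" using kD by simp
  define x1 where "x1 = max x0 ((k - \<gamma>) powr (1 / \<alpha>))"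
  have "k - \<gamma> = ((k - \<gamma>) powr (1 / \<alpha>)) powr \<alpha>" using assms by (simp add: powr_powr)
  also have "\<dots> \<le> x1 powr \<alpha>" using assms by (intro powr_mono2) (auto simp: x1_def)
  finally have "x1 powr \<alpha> \<ge> k - \<gamma>" .
  moreover have "exp (- x1 * \<tau>1) \<le> 1" using assms x0 by (simp add: x1_def)
  then have "k * exp (- x1 * \<tau>1) \<le> k" using assms by (simp add: mult_left_le)
  moreover have "k * exp (- (x1 + \<gamma>) * \<tau>2 - x1 * \<tau>1) \<ge> 0" using assms by simp
  ultimately have pos: "0 \<le> F x1" unfolding F_def by linarith
  have "continuous_on {x0..x1} F"
    unfolding F_def using x0 by (intro continuous_intros) auto
  from IVT'[OF neg pos _ this] obtain x where "x0 \<le> x" "F x = 0" by (auto simp: x1_def)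
  then show ?thesis using that[of x] x0 char_fun_of_real[of x \<alpha> \<gamma> \<tau>1 \<tau>2 k] by (simp add: F_def)
qed

lemma norm_char_fun_ge:
  assumes "Re z > 0" "\<tau>1 > 0" "\<tau>2 > 0" "k > 0"
  shows "norm (char_fun \<alpha> \<gamma> \<tau>1 \<tau>2 k z) \<ge> norm z powr \<alpha> - (\<bar>\<gamma>\<bar> + k + k * exp (- \<gamma> * \<tau>2))"
proof -
  have "norm (z powr of_real \<alpha>) = norm z powr \<alpha>" using assms by (simp add: norm_powr_real_powr')
  moreover have "norm (of_real k * exp (- z * of_real \<tau>1)) \<le> k"
    using assms by (simp add: norm_mult mult_left_le)
  moreover have "norm (of_real k * exp (- (z + of_real \<gamma>) * of_real \<tau>2 - z * of_real \<tau>1)) \<le> k * exp (- \<gamma> * \<tau>2)"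
  proof -
    have "- \<gamma> * \<tau>2 - (- (Re z + \<gamma>) * \<tau>2 - Re z * \<tau>1) = Re z * (\<tau>1 + \<tau>2)" by (simp add: algebra_simps)
    moreover have "Re z * (\<tau>1 + \<tau>2) \<ge> 0" using assms by simp
    ultimately have "- (Re z + \<gamma>) * \<tau>2 - Re z * \<tau>1 \<le> - \<gamma> * \<tau>2" by linarith
    moreover have "norm (of_real k * exp (- (z + of_real \<gamma>) * of_real \<tau>2 - z * of_real \<tau>1)) = k * exp (- (Re z + \<gamma>) * \<tau>2 - Re z * \<tau>1)"
      using assms by (simp add: norm_mult)
    ultimately show ?thesis using assms by simp
  qed
  moreover have "norm (z powr of_real \<alpha>) \<le> norm (char_fun \<alpha> \<gamma> \<tau>1 \<tau>2 k z) + norm (of_real \<gamma> :: complex)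
     + norm (of_real k * exp (- z * of_real \<tau>1)) + norm (of_real k * exp (- (z + of_real \<gamma>) * of_real \<tau>2 - z * of_real \<tau>1))"
  proof -
    have "z powr of_real \<alpha> = char_fun \<alpha> \<gamma> \<tau>1 \<tau>2 k z - of_real \<gamma> + of_real k * exp (- z * of_real \<tau>1)
      - of_real k * exp (- (z + of_real \<gamma>) * of_real \<tau>2 - z * of_real \<tau>1)" by (simp add: char_fun_def)
    then show ?thesis by (smt (verit) norm_triangle_ineq norm_triangle_ineq4)
  qed
  ultimately show ?thesis by simp
qed

lemma char_fun_holomorphic: "char_fun \<alpha> \<gamma> \<tau>1 \<tau>2 k holomorphic_on {z. Re z > 0}"
  unfolding char_fun_def[abs_def]
  by (intro holomorphic_intros) (auto simp: complex_nonpos_Reals_iff)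

text \<open>
  In a vertical strip inside the right half-plane the zeros lie in a rectangle, because
  \<open>z powr \<alpha>\<close> dominates far out; so they are finitely many and some vertical line between the
  imaginary axis and the given root avoids them all.
\<close>

lemma char_fun_zero_free_line:
  assumes "0 < \<alpha>" "\<tau>1 > 0" "\<tau>2 > 0" "k > 0" "x > 0" and root: "char_fun \<alpha> \<gamma> \<tau>1 \<tau>2 k (of_real x) = 0"
  obtains \<sigma> c where "0 < \<sigma>" "\<sigma> < x" "c > 0" "\<And>b. norm (char_fun \<alpha> \<gamma> \<tau>1 \<tau>2 k (of_real \<sigma> + \<i> * of_real b)) \<ge> c"
proof -
  let ?F = "char_fun \<alpha> \<gamma> \<tau>1 \<tau>2 k" and ?S = "{z. Re z > 0}"
  define K where "K = \<bar>\<gamma>\<bar> + k + k * exp (- \<gamma> * \<tau>2)"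
  have K0: "K > 0" using assms by (simp add: K_def add_nonneg_pos add_pos_pos)
  define R where "R = (K + 1) powr (1 / \<alpha>)"
  have R0: "R > 0" using K0 by (simp add: R_def)
  have big: "norm (?F z) \<ge> 1" if "Re z > 0" "norm z \<ge> R" for z
  proof -
    have "K + 1 = R powr \<alpha>" using K0 assms by (simp add: R_def powr_powr)
    also have "\<dots> \<le> norm z powr \<alpha>" using that R0 assms by (intro powr_mono2) auto
    finally show ?thesis using norm_char_fun_ge[OF that(1) assms(2-4), of \<alpha> \<gamma>] by (simp add: K_def)
  qed
  have nc: "\<not> ?F constant_on ?S"
  proof
    assume "?F constant_on ?S"
    then have "?F (of_real R) = ?F (of_real x)" using R0 assms by (auto simp: constant_on_def)
    then show False using big[of "of_real R"] R0 root by simp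
  qed
  define Z where "Z = {z \<in> cbox (Complex (x / 4) (- R)) (Complex (x / 2) R). ?F z = 0}"
  have "finite Z"
    unfolding Z_def
  proof (rule holomorphic_compact_finite_zeros[OF char_fun_holomorphic _ _ _ _ nc])
    show "open ?S" by (rule open_halfspace_Re_gt)
    show "connected ?S" by (intro convex_connected convex_halfspace_Re_gt)
    show "cbox (Complex (x / 4) (- R)) (Complex (x / 2) R) \<subseteq> ?S"
      using assms by (auto simp: in_cbox_complex_iff)
  qed simp
  then have "finite (Re ` Z)" by simp
  moreover have "infinite {x / 4..x / 2}" using assms by simp
  ultimately obtain \<sigma> where \<sigma>: "\<sigma> \<in> {x / 4..x / 2}" "\<sigma> \<notin> Re ` Z"
    by (meson finite_subset subsetI)
  have s0: "\<sigma> > 0" "\<sigma> < x" using \<sigma> assms by auto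
  have nz: "?F (of_real \<sigma> + \<i> * of_real b) \<noteq> 0" if "\<bar>b\<bar> \<le> R" for b
  proof
    assume "?F (of_real \<sigma> + \<i> * of_real b) = 0"
    then have "of_real \<sigma> + \<i> * of_real b \<in> Z" using \<sigma> that by (auto simp: Z_def in_cbox_complex_iff)
    then show False using \<sigma>(2) by (auto simp: image_iff intro: bexI[of _ "of_real \<sigma> + \<i> * of_real b"])
  qed
  have "continuous_on {- R..R} (\<lambda>b. norm (?F (of_real \<sigma> + \<i> * of_real b)))"
    using s0 by (intro continuous_intros continuous_on_compose2[OF holomorphic_on_imp_continuous_on[OF char_fun_holomorphic]]) auto
  from continuous_attains_inf[OF compact_Icc _ this] R0
  obtain b0 where b0: "b0 \<in> {- R..R}" "\<And>b. b \<in> {- R..R} \<Longrightarrow> norm (?F (of_real \<sigma> + \<i> * of_real b0)) \<le> norm (?F (of_real \<sigma> + \<i> * of_real b))"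
    by force
  show ?thesis
  proof (rule that[OF s0, of "min 1 (norm (?F (of_real \<sigma> + \<i> * of_real b0)))"])
    show "min 1 (norm (?F (of_real \<sigma> + \<i> * of_real b0))) > 0" using nz[of b0] b0(1) by (simp add: abs_le_iff)
    show "min 1 (norm (?F (of_real \<sigma> + \<i> * of_real b0))) \<le> norm (?F (of_real \<sigma> + \<i> * of_real b))" for b
    proof (cases "\<bar>b\<bar> \<le> R")
      case True
      then have "b \<in> {- R..R}" by auto
      then show ?thesis by (intro min.coboundedI2 b0(2))
    next
      case False
      then have "norm (of_real \<sigma> + \<i> * of_real b) \<ge> R"
        using abs_Im_le_cmod[of "of_real \<sigma> + \<i> * of_real b"] by simp
      then show ?thesis using big[of "of_real \<sigma> + \<i> * of_real b"] s0 by simp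
    qed
  qed
qed

section \<open>The delay equation in the Laplace domain\<close>

lemma started_damped_integrable:
  fixes s :: complex
  assumes y: "started y" and B: "\<And>t. \<bar>y t\<bar> \<le> B" and "Re s > 0"
  shows "integrable lborel (\<lambda>t. of_real (y t) * exp (- s * of_real t))"
proof -
  have [measurable]: "y \<in> borel_measurable borel"
    using y by (auto simp: started_def intro: borel_measurable_continuous_onI)
  have "integrable lborel (\<lambda>t. frac_kernel 1 t * exp (- Re s * t))"
    using laplace_frac_kernel_real[of 1 "Re s"] assms by (simp add: has_bochner_integral_iff)
  then have d: "integrable lborel (\<lambda>t. B * (frac_kernel 1 t * exp (- Re s * t)))" by simp
  show ?thesis
  proof (rule Bochner_Integration.integrable_bound[OF d])
    have "norm (of_real (y t) * exp (- s * of_real t)) \<le> norm (B * (frac_kernel 1 t * exp (- Re s * t)))" for t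
    proof (cases "t \<le> 0")
      case True
      then have "y t = 0" using y by (simp add: started_def)
      then show ?thesis by simp
    next
      case False
      then show ?thesis using B[of t] order_trans[OF B abs_ge_self, of t]
        by (simp add: norm_mult frac_kernel_def abs_mult)
    qed
    then show "AE t in lborel. norm (of_real (y t) * exp (- s * of_real t)) \<le> norm (B * (frac_kernel 1 t * exp (- Re s * t)))"
      by simp
  qed measurable
qed

lemma started_damped_integrable_real:
  assumes y: "started y" and B: "\<And>t. \<bar>y t\<bar> \<le> B" and "r > 0"
  shows "integrable lborel (\<lambda>t. y t * exp (- r * t))"
    and "integrable lborel (\<lambda>t. (y t * exp (- r * t))\<^sup>2)"
proof -
  have *: "integrable lborel (\<lambda>t. z t * exp (- q * t))" if "started z" "\<And>t. \<bar>z t\<bar> \<le> C" "q > 0" for z C q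
  proof -
    have "integrable lborel (\<lambda>t. complex_of_real (z t * exp (- q * t)))"
      using started_damped_integrable[OF that(1,2), of "of_real q"] that(3)
      by (simp add: exp_of_real[symmetric] del: exp_of_real)
    from integrable_Re[OF this] show ?thesis by (simp only: Re_complex_of_real)
  qed
  show "integrable lborel (\<lambda>t. y t * exp (- r * t))" by (rule *[OF y B \<open>r > 0\<close>])
  have "started (\<lambda>t. (y t)\<^sup>2)" using y by (auto simp: started_def intro!: continuous_intros)
  moreover have "\<bar>(y t)\<^sup>2\<bar> \<le> B\<^sup>2" for t using power_mono[OF B[of t], of 2] by simp
  ultimately have "integrable lborel (\<lambda>t. (y t)\<^sup>2 * exp (- (2 * r) * t))" using \<open>r > 0\<close> by (intro *) auto
  moreover have "(y t * exp (- r * t))\<^sup>2 = (y t)\<^sup>2 * exp (- (2 * r) * t)" for t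
    by (simp add: power_mult_distrib exp_of_nat_mult[symmetric])
  ultimately show "integrable lborel (\<lambda>t. (y t * exp (- r * t))\<^sup>2)" by simp
qed

lemma laplace_shift:
  "laplace (\<lambda>t. y (t - \<tau>)) s = exp (- s * of_real \<tau>) * laplace y s"
proof -
  have "laplace (\<lambda>t. y (t - \<tau>)) s = (\<integral>t. exp (- s * of_real \<tau>) * (of_real (y (t - \<tau>)) * exp (- s * of_real (t - \<tau>))) \<partial>lborel)"
    unfolding laplace_def
  proof (rule Bochner_Integration.integral_cong[OF refl])
    fix t
    have "exp (- s * of_real t) = exp (- s * of_real \<tau>) * exp (- s * of_real (t - \<tau>))"
      by (simp add: mult_exp_exp algebra_simps)
    then show "of_real (y (t - \<tau>)) * exp (- s * of_real t) = exp (- s * of_real \<tau>) * (of_real (y (t - \<tau>)) * exp (- s * of_real (t - \<tau>)))"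
      by (simp only: ac_simps)
  qed
  also have "\<dots> = exp (- s * of_real \<tau>) * laplace y s"
    using lborel_integral_shift(1)[of "\<lambda>t. of_real (y t) * exp (- s * of_real t)" \<tau>]
    by (simp add: laplace_def)
  finally show ?thesis .
qed

lemma laplace_damped:
  "laplace (\<lambda>t. y t * exp (- \<sigma> * t)) (\<i> * of_real b) = laplace y (of_real \<sigma> + \<i> * of_real b)"
  unfolding laplace_def
proof (rule Bochner_Integration.integral_cong[OF refl])
  fix t
  have "complex_of_real (exp (- \<sigma> * t)) * exp (- (\<i> * of_real b) * of_real t) = exp (- (of_real \<sigma> + \<i> * of_real b) * of_real t)"
    by (simp add: exp_of_real[symmetric] mult_exp_exp algebra_simps del: exp_of_real)
  then show "of_real (y t * exp (- \<sigma> * t)) * exp (- (\<i> * of_real b) * of_real t)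
      = of_real (y t) * exp (- (of_real \<sigma> + \<i> * of_real b) * of_real t)"
    by (simp only: of_real_mult mult.assoc)
qed

lemma laplace_of_real:
  "laplace y (of_real r) = of_real (\<integral>t. y t * exp (- r * t) \<partial>lborel)"
  unfolding laplace_def integral_complex_of_real[symmetric]
  by (rule Bochner_Integration.integral_cong[OF refl]) (simp add: exp_of_real[symmetric] del: exp_of_real)

text \<open>
  The transformed equation, with \<open>g \<circ> x\<close> split into its linear part and a remainder \<open>n\<close>; the function
  \<open>p\<close> carries the contribution of the history. The transform turns the fractional integral into
  multiplication by \<open>s powr (- \<alpha>)\<close> and the delays into exponentials, which assemble to
  the characteristic function.
\<close>

lemma laplace_delay_equation:
  fixes s :: complex and x n p :: "real \<Rightarrow> real" and \<gamma> \<tau>1 \<tau>2 k \<alpha> :: real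
  defines "e \<equiv> exp (- \<gamma> * \<tau>2)"
  assumes "\<alpha> > 0" "\<tau>1 > 0" "\<tau>2 > 0" and s: "Re s > 0"
    and x: "started x" "\<And>t. \<bar>x t\<bar> \<le> B1" and n: "started n" "\<And>t. \<bar>n t\<bar> \<le> B2" and p: "started p" "\<And>t. \<bar>p t\<bar> \<le> B3"
    and eq: "\<And>t. x t = (\<integral>v. frac_kernel \<alpha> v * (- \<gamma> * x (t - v)
       + (k * x (t - v - \<tau>1) + n (t - v - \<tau>1) - e * (k * x (t - v - \<tau>1 - \<tau>2) + n (t - v - \<tau>1 - \<tau>2)) - e * p (t - v))) \<partial>lborel)"
  shows "char_fun \<alpha> \<gamma> \<tau>1 \<tau>2 k s * laplace x s
     = (exp (- s * of_real \<tau>1) - of_real e * exp (- s * of_real (\<tau>1 + \<tau>2))) * laplace n s - of_real e * laplace p s"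
proof -
  let ?J = "\<lambda>y t. complex_of_real (y t) * exp (- s * of_real t)"
  define f where "f t = - \<gamma> * x t
       + (k * x (t - \<tau>1) + n (t - \<tau>1) - e * (k * x (t - (\<tau>1 + \<tau>2)) + n (t - (\<tau>1 + \<tau>2))) - e * p t)" for t
  have sh: "integrable lborel (?J (\<lambda>t. y (t - \<tau>)))" if "started y" "\<And>t. \<bar>y t\<bar> \<le> B" "\<tau> > 0" for y B \<tau>
  proof (rule started_damped_integrable[OF _ _ s])
    show "started (\<lambda>t. y (t - \<tau>))"
      using that continuous_on_compose2[of UNIV y UNIV "\<lambda>t. t - \<tau>", OF _ continuous_on_diff[OF continuous_on_id continuous_on_const]]
      by (auto simp: started_def)
    show "\<bar>y (t - \<tau>)\<bar> \<le> B" for t using that by simp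
  qed
  note I = started_damped_integrable[OF x s] started_damped_integrable[OF p s]
    sh[OF x \<open>\<tau>1 > 0\<close>] sh[OF n \<open>\<tau>1 > 0\<close>] sh[OF x add_pos_pos[OF \<open>\<tau>1 > 0\<close> \<open>\<tau>2 > 0\<close>]]
    sh[OF n add_pos_pos[OF \<open>\<tau>1 > 0\<close> \<open>\<tau>2 > 0\<close>]]
  have fJ: "?J f = (\<lambda>t. - of_real \<gamma> * ?J x t
      + (of_real k * ?J (\<lambda>t. x (t - \<tau>1)) t + ?J (\<lambda>t. n (t - \<tau>1)) t
         - of_real e * (of_real k * ?J (\<lambda>t. x (t - (\<tau>1 + \<tau>2))) t + ?J (\<lambda>t. n (t - (\<tau>1 + \<tau>2))) t) - of_real e * ?J p t))"
    unfolding f_def by (simp add: algebra_simps fun_eq_iff)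
  have hb: "has_bochner_integral lborel (?J f) (- of_real \<gamma> * laplace x s
      + (of_real k * laplace (\<lambda>t. x (t - \<tau>1)) s + laplace (\<lambda>t. n (t - \<tau>1)) s
         - of_real e * (of_real k * laplace (\<lambda>t. x (t - (\<tau>1 + \<tau>2))) s + laplace (\<lambda>t. n (t - (\<tau>1 + \<tau>2))) s) - of_real e * laplace p s))"
    unfolding fJ laplace_def
    by (intro has_bochner_integral_add has_bochner_integral_diff has_bochner_integral_mult_right has_bochner_integral_integrable)
      (use I in auto)
  have "laplace x s = s powr (- of_real \<alpha>) * laplace f s"
  proof (rule laplace_frac_integral[OF \<open>\<alpha> > 0\<close> s])
    show "integrable lborel (?J f)" using hb by (simp add: has_bochner_integral_iff)
    show "x t = (\<integral>v. frac_kernel \<alpha> v * f (t - v) \<partial>lborel)" for t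
      unfolding eq[of t] f_def by (simp add: diff_diff_eq add.assoc)
  qed
  moreover have "s powr of_real \<alpha> * s powr (- of_real \<alpha>) = 1"
  proof -
    have "s \<noteq> 0" using s by auto
    then show ?thesis by (simp add: powr_minus)
  qed
  ultimately have sX: "s powr of_real \<alpha> * laplace x s = laplace f s" by (simp add: mult.assoc[symmetric])
  define X N P where "X = laplace x s" and "N = laplace n s" and "P = laplace p s"
  define E1 E2 where "E1 = exp (- s * of_real \<tau>1)" and "E2 = exp (- s * of_real (\<tau>1 + \<tau>2))"
  have "laplace f s = - of_real \<gamma> * X + (of_real k * (E1 * X) + E1 * N - of_real e * (of_real k * (E2 * X) + E2 * N) - of_real e * P)"
    using hb has_bochner_integral_integral_eq[OF hb] unfolding laplace_shift X_def N_def P_def E1_def E2_def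
    by (simp add: laplace_def[of f])
  moreover have "exp (- (s + of_real \<gamma>) * of_real \<tau>2 - s * of_real \<tau>1) = of_real e * E2"
  proof -
    have e: "complex_of_real e = exp (- of_real \<gamma> * of_real \<tau>2)"
      by (simp add: e_def exp_of_real[symmetric] del: exp_of_real)
    have "- (s + of_real \<gamma>) * of_real \<tau>2 - s * of_real \<tau>1 = - of_real \<gamma> * of_real \<tau>2 + - s * of_real (\<tau>1 + \<tau>2)"
      by (simp add: algebra_simps)
    then show ?thesis by (simp only: e E2_def exp_add)
  qed
  ultimately show ?thesis
    using sX unfolding char_fun_def X_def[symmetric] N_def[symmetric] P_def[symmetric] E1_def[symmetric] E2_def[symmetric]
    by (simp add: algebra_simps)
qed

text \<open>
  The shape of the history used below: it is supported on \<open>[- (\<tau>1 + \<tau>2), - \<tau>1]\<close> after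
  translation by \<open>\<tau>1 + \<tau>2\<close>. It vanishes at both ends, which makes the forcing of the integral equation
  continuous and the solution start from \<open>0\<close>, so that no initial value appears in the transforms.
\<close>

definition bump :: "real \<Rightarrow> real \<Rightarrow> real" where
  "bump \<tau> t = max 0 (t * (\<tau> - t))"

lemma bump_started: "\<tau> > 0 \<Longrightarrow> started (bump \<tau>)"
  by (auto simp: started_def bump_def mult_nonpos_nonneg intro!: continuous_intros)

lemma bump_eq_0: "\<tau> \<le> t \<Longrightarrow> \<tau> > 0 \<Longrightarrow> bump \<tau> t = 0"
  by (simp add: bump_def mult_nonneg_nonpos)

lemma bump_nonneg: "bump \<tau> t \<ge> 0"
  by (simp add: bump_def)

lemma bump_le: "\<bar>bump \<tau> t\<bar> \<le> \<tau>\<^sup>2"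
proof -
  have "\<tau>\<^sup>2 - t * (\<tau> - t) = (t - \<tau> / 2)\<^sup>2 + 3 / 4 * \<tau>\<^sup>2"
    by (simp add: power2_eq_square field_simps)
  moreover have "(t - \<tau> / 2)\<^sup>2 + 3 / 4 * \<tau>\<^sup>2 \<ge> 0" by simp
  ultimately have "t * (\<tau> - t) \<le> \<tau>\<^sup>2" by linarith
  then show ?thesis by (simp add: bump_def)
qed

lemma laplace_bump_pos:
  assumes "\<tau> > 0" "r > 0"
  shows "(\<integral>t. bump \<tau> t * exp (- r * t) \<partial>lborel) > 0"
proof -
  define c where "c = (3 / 16 * \<tau>\<^sup>2) * exp (- r * \<tau>)"
  have c0: "c > 0" using assms by (simp add: c_def)
  have i: "integrable lborel (\<lambda>t. bump \<tau> t * exp (- r * t))"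
    by (rule started_damped_integrable_real(1)[OF bump_started[OF assms(1)] bump_le assms(2)])
  have "0 < c * (\<tau> / 2)" using c0 assms by simp
  also have "\<dots> = (\<integral>t. c * indicator {\<tau> / 4..3 * \<tau> / 4} t \<partial>lborel)" using assms by simp
  also have "\<dots> \<le> (\<integral>t. bump \<tau> t * exp (- r * t) \<partial>lborel)"
  proof (rule integral_mono[OF _ i])
    show "integrable lborel (\<lambda>t. c * indicator {\<tau> / 4..3 * \<tau> / 4} t)"
      by (intro integrable_mult_right integrable_real_indicator) (auto simp: emeasure_lborel_Icc_eq)
    fix t
    show "c * indicator {\<tau> / 4..3 * \<tau> / 4} t \<le> bump \<tau> t * exp (- r * t)"
    proof (cases "t \<in> {\<tau> / 4..3 * \<tau> / 4}")
      case True
      have "(t - \<tau> / 4) * (3 * \<tau> / 4 - t) \<ge> 0" using True by (intro mult_nonneg_nonneg) auto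
      moreover have "t * (\<tau> - t) - 3 / 16 * \<tau>\<^sup>2 = (t - \<tau> / 4) * (3 * \<tau> / 4 - t)"
        by (simp add: power2_eq_square field_simps)
      ultimately have "3 / 16 * \<tau>\<^sup>2 \<le> t * (\<tau> - t)" by linarith
      then have "3 / 16 * \<tau>\<^sup>2 \<le> bump \<tau> t" by (simp add: bump_def)
      moreover have "exp (- r * \<tau>) \<le> exp (- r * t)" using True assms by auto
      ultimately have "c \<le> bump \<tau> t * exp (- r * t)"
        unfolding c_def by (intro mult_mono) (auto simp: bump_nonneg)
      then show ?thesis using True by simp
    qed (simp add: bump_nonneg)
  qed
  finally show ?thesis .
qed

text \<open>
  Plancherel on the vertical line with real part \<open>\<sigma>\<close>, where the Laplace transform is the Fourier
  transform of the function damped by \<open>exp (- \<sigma> t)\<close>.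
\<close>

lemma damped_energy_bound:
  assumes x: "started x" "\<And>t. \<bar>x t\<bar> \<le> B1" and n: "started n" "\<And>t. \<bar>n t\<bar> \<le> B2"
    and p: "started p" "\<And>t. \<bar>p t\<bar> \<le> B3" and "\<sigma> > 0"
    and line: "\<And>b. norm (laplace x (of_real \<sigma> + \<i> * of_real b))
      \<le> C * (norm (laplace n (of_real \<sigma> + \<i> * of_real b)) + norm (laplace p (of_real \<sigma> + \<i> * of_real b)))"
  shows "(\<integral>t. (x t * exp (- \<sigma> * t))\<^sup>2 \<partial>lborel)
    \<le> 2 * C\<^sup>2 * ((\<integral>t. (n t * exp (- \<sigma> * t))\<^sup>2 \<partial>lborel) + (\<integral>t. (p t * exp (- \<sigma> * t))\<^sup>2 \<partial>lborel))"
proof (rule plancherel_domination)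
  show "integrable lborel (\<lambda>t. x t * exp (- \<sigma> * t))" "integrable lborel (\<lambda>t. (x t * exp (- \<sigma> * t))\<^sup>2)"
    by (rule started_damped_integrable_real[OF x \<open>\<sigma> > 0\<close>])+
  show "integrable lborel (\<lambda>t. n t * exp (- \<sigma> * t))" "integrable lborel (\<lambda>t. (n t * exp (- \<sigma> * t))\<^sup>2)"
    by (rule started_damped_integrable_real[OF n \<open>\<sigma> > 0\<close>])+
  show "integrable lborel (\<lambda>t. p t * exp (- \<sigma> * t))" "integrable lborel (\<lambda>t. (p t * exp (- \<sigma> * t))\<^sup>2)"
    by (rule started_damped_integrable_real[OF p \<open>\<sigma> > 0\<close>])+
  show "continuous_on UNIV (\<lambda>t. x t * exp (- \<sigma> * t))" using x by (auto simp: started_def intro!: continuous_intros)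
  show "\<bar>x t * exp (- \<sigma> * t)\<bar> \<le> B1" for t
  proof (cases "t \<le> 0")
    case True then show ?thesis using x(1) order_trans[OF abs_ge_zero x(2)] by (simp add: started_def)
  next
    case False
    then have "exp (- \<sigma> * t) \<le> 1" using \<open>\<sigma> > 0\<close> by simp
    then have "\<bar>x t\<bar> * exp (- \<sigma> * t) \<le> B1 * 1" using x(2)[of t] by (intro mult_mono) auto
    then show ?thesis by (simp add: abs_mult)
  qed
  show "2 * C\<^sup>2 \<ge> 0" by simp
  fix b
  let ?s = "of_real \<sigma> + \<i> * of_real b :: complex"
  let ?N = "norm (laplace n ?s)" and ?P = "norm (laplace p ?s)"
  have "(norm (laplace x ?s))\<^sup>2 \<le> (C * (?N + ?P))\<^sup>2" using line by (intro power_mono) auto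
  also have "\<dots> = C\<^sup>2 * (?N + ?P)\<^sup>2" by (rule power_mult_distrib)
  also have "\<dots> \<le> C\<^sup>2 * (2 * (?N\<^sup>2 + ?P\<^sup>2))"
    using sum_squares_bound[of ?N ?P] by (intro mult_left_mono) (auto simp: power2_sum)
  also have "\<dots> = 2 * C\<^sup>2 * (?N\<^sup>2 + ?P\<^sup>2)" by simp
  finally show "(norm (laplace (\<lambda>t. x t * exp (- \<sigma> * t)) (\<i> * of_real b)))\<^sup>2
     \<le> 2 * C\<^sup>2 * ((norm (laplace (\<lambda>t. n t * exp (- \<sigma> * t)) (\<i> * of_real b)))\<^sup>2
        + (norm (laplace (\<lambda>t. p t * exp (- \<sigma> * t)) (\<i> * of_real b)))\<^sup>2)"
    unfolding laplace_damped .
qed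

text \<open>
  The gap between \<open>\<sigma>\<close> and \<open>\<rho>\<close> pays for the passage from square integrals to integrals. The
  arithmetic-geometric mean inequality with a free weight \<open>d\<close> replaces the Cauchy--Schwarz inequality;
  \<open>d\<close> will be the amplitude of the history, so that both summands are proportional to it.
\<close>

lemma abs_laplace_le_energy:
  fixes w d \<sigma> \<rho> :: real
  assumes x: "started x" "\<And>t. \<bar>x t\<bar> \<le> B1" and n: "started n" "\<And>t. \<bar>n t\<bar> \<le> B2"
    and nx: "\<And>t. \<bar>n t\<bar> \<le> w * \<bar>x t\<bar>" and "w \<ge> 0" "d > 0" and \<sigma>: "0 < \<sigma>" "\<sigma> < \<rho>"
  shows "\<bar>\<integral>t. n t * exp (- \<rho> * t) \<partial>lborel\<bar>
    \<le> w * (d / (4 * (\<rho> - \<sigma>)) + 1 / (2 * d) * (\<integral>t. (x t * exp (- \<sigma> * t))\<^sup>2 \<partial>lborel))"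
proof -
  define u where "u t = x t * exp (- \<sigma> * t)" for t
  have iu: "integrable lborel (\<lambda>t. (u t)\<^sup>2)"
    unfolding u_def by (rule started_damped_integrable_real(2)[OF x \<sigma>(1)])
  have hI: "has_bochner_integral lborel (\<lambda>t. frac_kernel 1 t * exp (- (2 * (\<rho> - \<sigma>)) * t)) (1 / (2 * (\<rho> - \<sigma>)))"
    using laplace_frac_kernel_real[of 1 "2 * (\<rho> - \<sigma>)"] \<sigma> by (simp add: powr_minus_divide)
  have "\<bar>\<integral>t. n t * exp (- \<rho> * t) \<partial>lborel\<bar>
      \<le> (\<integral>t. w * (d / 2 * (frac_kernel 1 t * exp (- (2 * (\<rho> - \<sigma>)) * t)) + 1 / (2 * d) * (u t)\<^sup>2) \<partial>lborel)"
    unfolding real_norm_def[symmetric]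
  proof (rule Bochner_Integration.integral_norm_bound_integral)
    show "integrable lborel (\<lambda>t. n t * exp (- \<rho> * t))"
      by (rule started_damped_integrable_real(1)[OF n]) (use \<sigma> in simp)
    show "integrable lborel (\<lambda>t. w * (d / 2 * (frac_kernel 1 t * exp (- (2 * (\<rho> - \<sigma>)) * t)) + 1 / (2 * d) * (u t)\<^sup>2))"
      using hI iu by (simp add: has_bochner_integral_iff)
    fix t
    show "norm (n t * exp (- \<rho> * t)) \<le> w * (d / 2 * (frac_kernel 1 t * exp (- (2 * (\<rho> - \<sigma>)) * t)) + 1 / (2 * d) * (u t)\<^sup>2)"
    proof (cases "t \<le> 0")
      case True
      then have "n t = 0" using n by (simp add: started_def)
      then show ?thesis using \<open>w \<ge> 0\<close> \<open>d > 0\<close> by (simp add: frac_kernel_nonneg)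
    next
      case False
      define q where "q = exp (- (\<rho> - \<sigma>) * t)"
      have "exp (- \<rho> * t) = q * exp (- \<sigma> * t)" by (simp add: q_def mult_exp_exp algebra_simps)
      then have "\<bar>x t\<bar> * exp (- \<rho> * t) = q * \<bar>u t\<bar>" by (simp add: u_def abs_mult)
      also have "\<dots> \<le> d / 2 * q\<^sup>2 + 1 / (2 * d) * (u t)\<^sup>2"
        using sum_squares_bound[of "d * q" "\<bar>u t\<bar>"] \<open>d > 0\<close> by (simp add: field_simps power2_eq_square)
      finally have "\<bar>x t\<bar> * exp (- \<rho> * t) \<le> d / 2 * q\<^sup>2 + 1 / (2 * d) * (u t)\<^sup>2" .
      moreover have "q\<^sup>2 = frac_kernel 1 t * exp (- (2 * (\<rho> - \<sigma>)) * t)"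
        using False by (simp add: q_def frac_kernel_def exp_of_nat_mult[symmetric] algebra_simps)
      ultimately have le: "\<bar>x t\<bar> * exp (- \<rho> * t) \<le> d / 2 * (frac_kernel 1 t * exp (- (2 * (\<rho> - \<sigma>)) * t)) + 1 / (2 * d) * (u t)\<^sup>2"
        by simp
      have "norm (n t * exp (- \<rho> * t)) \<le> w * \<bar>x t\<bar> * exp (- \<rho> * t)"
        using nx[of t] by (simp add: abs_mult mult_right_mono)
      also have "\<dots> = w * (\<bar>x t\<bar> * exp (- \<rho> * t))" by simp
      also have "\<dots> \<le> w * (d / 2 * (frac_kernel 1 t * exp (- (2 * (\<rho> - \<sigma>)) * t)) + 1 / (2 * d) * (u t)\<^sup>2)"
        using \<open>w \<ge> 0\<close> by (intro mult_left_mono le)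
      finally show ?thesis .
    qed
  qed
  also have "\<dots> = w * (d / 2 * (1 / (2 * (\<rho> - \<sigma>))) + 1 / (2 * d) * (\<integral>t. (u t)\<^sup>2 \<partial>lborel))"
    using hI iu by (simp add: has_bochner_integral_iff)
  finally show ?thesis by (simp add: u_def)
qed

section \<open>Solutions with small histories\<close>

lemma delay_equation_solution:
  fixes g :: "real \<Rightarrow> real" and \<gamma> e d :: real
  assumes "\<alpha> > 0" "\<tau>1 > 0" "\<tau>2 > 0" and g: "continuous_on UNIV g" "g 0 = 0"
  obtains x f where "started x" "started f" "\<And>t. x t = (\<integral>v. frac_kernel \<alpha> v * f (t - v) \<partial>lborel)"
    "\<And>t. f t = - \<gamma> * x t + (g (x (t - \<tau>1)) - e * g (x (t - \<tau>1 - \<tau>2)) - e * g (d * bump \<tau>2 t))"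
proof -
  define \<Psi> where "\<Psi> y t = g (y (t - \<tau>1)) - e * g (y (t - \<tau>1 - \<tau>2)) - e * g (d * bump \<tau>2 t)" for y t
  have b: "started (bump \<tau>2)" by (rule bump_started) fact
  have gc: "continuous_on UNIV (\<lambda>t. g (h t))" if "continuous_on UNIV h" for h :: "real \<Rightarrow> real"
    by (rule continuous_on_compose2[OF g(1) that]) simp
  have yc: "continuous_on UNIV (\<lambda>t. y (t - c))" if "continuous_on UNIV y" for y :: "real \<Rightarrow> real" and c
    by (rule continuous_on_compose2[OF that continuous_on_diff[OF continuous_on_id continuous_on_const]]) simp
  have start: "started (\<Psi> y)" if y: "started y" for y
  proof -
    have "continuous_on UNIV y" "continuous_on UNIV (bump \<tau>2)" using y b by (auto simp: started_def)
    then have "continuous_on UNIV (\<Psi> y)"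
      unfolding \<Psi>_def diff_diff_eq by (intro continuous_intros gc yc)
    moreover have "\<Psi> y t = 0" if "t \<le> 0" for t
      using y b that assms by (simp add: \<Psi>_def started_def)
    ultimately show ?thesis by (simp add: started_def)
  qed
  have causal: "\<Psi> y t = \<Psi> y' t" if "\<And>t. t \<le> T \<Longrightarrow> y t = y' t" "t \<le> T + \<tau>1" for y y' T t
    using that assms by (simp add: \<Psi>_def)
  have "\<exists>x. started x \<and> (\<forall>t. x t = (\<integral>s. frac_kernel \<alpha> s * (- \<gamma> * x (t - s) + \<Psi> x (t - s)) \<partial>lborel))"
  proof (rule volterra_delay_solution[OF assms(1,2) start])
    show "\<Psi> y t = \<Psi> y' t" if "\<And>t. t \<le> T \<Longrightarrow> y t = y' t" "t \<le> T + \<tau>1" for y y' T t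
      using that by (rule causal)
  qed
  then obtain x where x: "started x"
      "\<And>t. x t = (\<integral>s. frac_kernel \<alpha> s * (- \<gamma> * x (t - s) + \<Psi> x (t - s)) \<partial>lborel)"
    by blast
  show ?thesis
  proof (rule that[OF x(1) _ x(2)])
    show "started (\<lambda>r. - \<gamma> * x r + \<Psi> x r)" using x(1) start[OF x(1)] by (auto simp: started_def intro!: continuous_intros)
    show "- \<gamma> * x t + \<Psi> x t = - \<gamma> * x t + (g (x (t - \<tau>1)) - e * g (x (t - \<tau>1 - \<tau>2)) - e * g (d * bump \<tau>2 t))" for t
      by (simp add: \<Psi>_def)
  qed
qed

text \<open>
  The solution is the sum of its history, a translated bump, and of its part after time \<open>0\<close>. Their
  supports are disjoint, which is why \<open>g\<close> of the sum splits although \<open>g\<close> is nonlinear.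
\<close>

lemma history_plus_started_solution:
  assumes \<alpha>: "0 < \<alpha>" "\<alpha> < 1" and \<tau>: "\<tau>1 > 0" "\<tau>2 > 0" and g0: "g 0 = 0"
    and x: "started x" and f: "started f" and xf: "\<And>t. x t = (\<integral>v. frac_kernel \<alpha> v * f (t - v) \<partial>lborel)"
    and f_eq: "\<And>t. f t = - \<gamma> * x t + (g (x (t - \<tau>1)) - exp (- \<gamma> * \<tau>2) * g (x (t - \<tau>1 - \<tau>2)) - exp (- \<gamma> * \<tau>2) * g (d * bump \<tau>2 t))"
  shows "caputo_dde_solution \<alpha> (\<tau>1 + \<tau>2) (delay_rhs \<gamma> \<tau>1 \<tau>2 g) (\<lambda>t. x t + d * bump \<tau>2 (t + (\<tau>1 + \<tau>2)))"
proof -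
  define z where "z t = x t + d * bump \<tau>2 (t + (\<tau>1 + \<tau>2))" for t
  have b: "started (bump \<tau>2)" by (rule bump_started) fact
  have x0: "x t = 0" if "t \<le> 0" for t using x that by (simp add: started_def)
  have b0: "bump \<tau>2 t = 0" if "t \<le> 0" for t using b that by (simp add: started_def)
  have b1: "bump \<tau>2 t = 0" if "t \<ge> \<tau>2" for t using bump_eq_0 that \<tau> by simp
  have zx: "z t = x t" if "t \<ge> - \<tau>1" for t using b1[of "t + (\<tau>1 + \<tau>2)"] that by (simp add: z_def)
  have "continuous_on UNIV (\<lambda>t. bump \<tau>2 (t + (\<tau>1 + \<tau>2)))"
    using b by (intro continuous_on_compose2[of UNIV "bump \<tau>2" UNIV "\<lambda>t. t + (\<tau>1 + \<tau>2)"] continuous_intros) (auto simp: started_def)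
  moreover have "continuous_on UNIV x" using x by (simp add: started_def)
  ultimately have "continuous_on UNIV z" unfolding z_def by (intro continuous_intros)
  then have "continuous_on {- (\<tau>1 + \<tau>2)..} z" by (rule continuous_on_subset) simp
  moreover have "has_caputo_derivative \<alpha> z (delay_rhs \<gamma> \<tau>1 \<tau>2 g z t) t" if t: "t > 0" for t
  proof -
    have "has_caputo_derivative \<alpha> z (f t) t"
    proof (rule caputo_derivative_frac_integral[OF \<alpha>])
      show "z t = (\<integral>v. frac_kernel \<alpha> v * f (t - v) \<partial>lborel)" if "t \<ge> 0" for t
        using zx[of t] xf[of t] that \<tau> by simp
    qed (use f t in \<open>auto simp: started_def\<close>)
    moreover have "delay_rhs \<gamma> \<tau>1 \<tau>2 g z t = f t"
    proof -
      have "g (z (t - \<tau>1 - \<tau>2)) = g (x (t - \<tau>1 - \<tau>2)) + g (d * bump \<tau>2 t)"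
      proof (cases "t \<le> \<tau>2")
        case True
        then have "x (t - \<tau>1 - \<tau>2) = 0" using \<tau> by (intro x0) simp
        then show ?thesis using g0 by (simp add: z_def)
      next
        case False
        then have "bump \<tau>2 t = 0" by (intro b1) simp
        then show ?thesis using g0 by (simp add: z_def)
      qed
      moreover have "z t = x t" "z (t - \<tau>1) = x (t - \<tau>1)" using zx t \<tau> by auto
      ultimately show ?thesis unfolding delay_rhs_def f_eq[of t] by (simp add: algebra_simps)
    qed
    ultimately show ?thesis by simp
  qed
  ultimately show ?thesis unfolding caputo_dde_solution_def z_def[abs_def, symmetric] by blast
qed

section \<open>Instability\<close>

text \<open>
  The contradiction behind instability. If the equilibrium were stable, the solution \<open>x\<close> started by a
  bump of amplitude \<open>d\<close> would stay in the neighbourhood where the nonlinearity deviates from \<open>k y\<close> by at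
  most \<open>w \<bar>y\<bar>\<close>, with \<open>w\<close> as small as desired. On a zero-free line left of the root the equation can
  be solved for the transform of \<open>x\<close>, and Plancherel bounds the damped energy of \<open>x\<close> by a multiple of
  \<open>d\<^sup>2\<close> that depends neither on \<open>w\<close> nor on \<open>d\<close>. At the root itself the transform of \<open>x\<close> drops out: the
  contribution of the history, at least of the order of \<open>d\<close>, has to be balanced by that of the nonlinear
  remainder, at most of the order of \<open>w d\<close>.
\<close>

lemma not_stable_of_positive_root:
  assumes \<alpha>: "0 < \<alpha>" "\<alpha> < 1" and \<tau>: "\<tau>1 > 0" "\<tau>2 > 0" and k: "k > 0"
    and root: "\<rho> > 0" "char_fun \<alpha> \<gamma> \<tau>1 \<tau>2 k (of_real \<rho>) = 0"
    and g: "continuous_on UNIV g" "g 0 = 0" "(g has_real_derivative k) (at 0)"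
  shows "\<not> stable \<alpha> (\<tau>1 + \<tau>2) (delay_rhs \<gamma> \<tau>1 \<tau>2 g) 0"
proof
  assume stable: "stable \<alpha> (\<tau>1 + \<tau>2) (delay_rhs \<gamma> \<tau>1 \<tau>2 g) 0"
  define e where "e = exp (- \<gamma> * \<tau>2)"
  have e0: "e > 0" by (simp add: e_def)
  obtain \<sigma> c where \<sigma>: "0 < \<sigma>" "\<sigma> < \<rho>" and c: "c > 0"
    and line: "\<And>b. norm (char_fun \<alpha> \<gamma> \<tau>1 \<tau>2 k (of_real \<sigma> + \<i> * of_real b)) \<ge> c"
    using char_fun_zero_free_line[OF \<alpha>(1) \<tau> k root] by blast
  define C where "C = (1 + e) / c"
  define A where "A = 2 * C\<^sup>2"
  have A0: "A > 0" using e0 c by (simp add: A_def C_def)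
  define m where "m = (\<integral>t. bump \<tau>2 t * exp (- \<rho> * t) \<partial>lborel)"
  have m0: "m > 0" unfolding m_def by (rule laplace_bump_pos) fact+
  define J where "J = (\<integral>t. (bump \<tau>2 t * exp (- \<sigma> * t))\<^sup>2 \<partial>lborel)"
  have J0: "J \<ge> 0" unfolding J_def by (intro Bochner_Integration.integral_nonneg) simp
  define D where "D = 1 / (4 * (\<rho> - \<sigma>)) + A * (k + 1)\<^sup>2 * J"
  have D0: "D \<ge> 0" using \<sigma> J0 A0 by (simp add: D_def)
  \<comment> \<open>The four bounds make \<open>g\<close> dominated by \<open>(k + 1) y\<close>, keep half of the linear history term, absorb
    the remainder into the energy, and produce the final contradiction; none involves \<open>d\<close>.\<close>
  define w where "w = min (min 1 (k / 2)) (min (1 / (2 * A)) (e * k * m / (4 * (1 + e) * (D + 1))))"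
  have w0: "w > 0" using k A0 e0 m0 D0 by (simp add: w_def)
  have w1: "w \<le> 1" "w \<le> k / 2" "A * w \<le> 1 / 2" "(1 + e) * (D + 1) * w \<le> e * k * m / 4"
  proof -
    show "w \<le> 1" unfolding w_def by (rule min.coboundedI1[OF min.cobounded1])
    show "w \<le> k / 2" unfolding w_def by (rule min.coboundedI1[OF min.cobounded2])
    have "w \<le> 1 / (2 * A)" unfolding w_def by (rule min.coboundedI2[OF min.cobounded1])
    then show "A * w \<le> 1 / 2" using A0 by (simp add: field_simps)
    have "w \<le> e * k * m / (4 * (1 + e) * (D + 1))" unfolding w_def by (rule min.coboundedI2[OF min.cobounded2])
    then have "w * (4 * (1 + e) * (D + 1)) \<le> e * k * m" using e0 D0 by (subst (asm) pos_le_divide_eq) auto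
    then show "(1 + e) * (D + 1) * w \<le> e * k * m / 4" by (simp add: algebra_simps)
  qed
  obtain \<epsilon> where \<epsilon>: "\<epsilon> > 0" and lin: "\<And>y. \<bar>y\<bar> < \<epsilon> \<Longrightarrow> \<bar>g y - k * y\<bar> \<le> w * \<bar>y\<bar>"
  proof -
    have "(g has_derivative (\<lambda>y. k * y)) (at 0)" using g(3) by (simp add: has_field_derivative_def)
    then obtain \<epsilon> where "\<epsilon> > 0" "\<forall>y. norm (y - 0) < \<epsilon> \<longrightarrow> norm (g y - g 0 - k * (y - 0)) \<le> w * norm (y - 0)"
      unfolding has_derivative_at_alt using w0 by blast
    then show ?thesis using that[of \<epsilon>] g(2) by simp
  qed
  obtain \<delta> where \<delta>: "\<delta> > 0"
    and small: "\<And>x. caputo_dde_solution \<alpha> (\<tau>1 + \<tau>2) (delay_rhs \<gamma> \<tau>1 \<tau>2 g) x \<Longrightarrow>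
        (\<forall>t\<in>{- (\<tau>1 + \<tau>2)..0}. \<bar>x t\<bar> < \<delta>) \<Longrightarrow> (\<forall>t\<ge>0. \<bar>x t\<bar> < \<epsilon>)"
    using stable \<epsilon> unfolding stable_def by (metis diff_zero)
  \<comment> \<open>The bump is at most \<open>\<tau>2\<^sup>2\<close>, so the history stays below both \<open>\<delta>\<close> and \<open>\<epsilon>\<close>.\<close>
  define d where "d = min \<delta> \<epsilon> / (2 * \<tau>2\<^sup>2)"
  have d0: "d > 0" using \<delta> \<epsilon> \<tau> by (simp add: d_def)
  have db: "\<bar>d * bump \<tau>2 t\<bar> < min \<delta> \<epsilon>" for t
  proof -
    have "\<bar>d * bump \<tau>2 t\<bar> \<le> d * \<tau>2\<^sup>2" using mult_left_mono[OF bump_le[of \<tau>2 t], of d] d0 by (simp add: abs_mult)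
    also have "\<dots> = min \<delta> \<epsilon> / 2" using \<tau> by (simp add: d_def)
    also have "\<dots> < min \<delta> \<epsilon>" using \<delta> \<epsilon> by linarith
    finally show ?thesis .
  qed
  obtain x f where x: "started x" and f: "started f" and xf: "\<And>t. x t = (\<integral>v. frac_kernel \<alpha> v * f (t - v) \<partial>lborel)"
    and f_eq: "\<And>t. f t = - \<gamma> * x t + (g (x (t - \<tau>1)) - e * g (x (t - \<tau>1 - \<tau>2)) - e * g (d * bump \<tau>2 t))"
    by (rule delay_equation_solution[OF \<alpha>(1) \<tau> g(1,2), of \<gamma> e d]) (rule that)
  have b: "started (bump \<tau>2)" by (rule bump_started) fact
  have x0: "x t = 0" if "t \<le> 0" for t using x that by (simp add: started_def)
  have xB: "\<bar>x t\<bar> < \<epsilon>" for t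
  proof (cases "t \<le> 0")
    case True then show ?thesis using x0 \<epsilon> by simp
  next
    case False
    have "\<forall>t\<ge>0. \<bar>x t + d * bump \<tau>2 (t + (\<tau>1 + \<tau>2))\<bar> < \<epsilon>"
    proof (rule small)
      show "caputo_dde_solution \<alpha> (\<tau>1 + \<tau>2) (delay_rhs \<gamma> \<tau>1 \<tau>2 g) (\<lambda>t. x t + d * bump \<tau>2 (t + (\<tau>1 + \<tau>2)))"
        by (rule history_plus_started_solution[OF \<alpha> \<tau> g(2) x f xf f_eq[unfolded e_def]])
      show "\<forall>t\<in>{- (\<tau>1 + \<tau>2)..0}. \<bar>x t + d * bump \<tau>2 (t + (\<tau>1 + \<tau>2))\<bar> < \<delta>"
        using x0 db by simp
    qed
    then have "\<bar>x t + d * bump \<tau>2 (t + (\<tau>1 + \<tau>2))\<bar> < \<epsilon>" using False by simp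
    then show ?thesis using bump_eq_0[of \<tau>2 "t + (\<tau>1 + \<tau>2)"] False \<tau> by simp
  qed
  define n where "n t = g (x t) - k * x t" for t
  define p where "p t = g (d * bump \<tau>2 t)" for t
  have gc: "continuous_on UNIV (\<lambda>t. g (h t))" if "continuous_on UNIV h" for h :: "real \<Rightarrow> real"
    by (rule continuous_on_compose2[OF g(1) that]) simp
  have nx: "\<bar>n t\<bar> \<le> w * \<bar>x t\<bar>" for t using lin[OF xB] by (simp add: n_def)
  have n: "started n" using x g(2) unfolding started_def n_def by (auto intro!: continuous_intros gc)
  have nB: "\<bar>n t\<bar> \<le> w * \<epsilon>" for t
    using order_trans[OF nx mult_left_mono[OF less_imp_le[OF xB]]] w0 by simp
  have plin: "\<bar>p t - k * (d * bump \<tau>2 t)\<bar> \<le> w * (d * bump \<tau>2 t)" for t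
    using lin[of "d * bump \<tau>2 t"] db[of t] d0 bump_nonneg[of \<tau>2 t] by (simp add: p_def abs_mult)
  have p: "started p" using b g(2) unfolding started_def p_def by (auto intro!: continuous_intros gc)
  have pb: "\<bar>p t\<bar> \<le> (k + 1) * d * bump \<tau>2 t" for t
  proof -
    have "d * bump \<tau>2 t \<ge> 0" using d0 bump_nonneg by simp
    then have "w * (d * bump \<tau>2 t) \<le> 1 * (d * bump \<tau>2 t)" "k * (d * bump \<tau>2 t) \<ge> 0"
      using w1 k by (intro mult_right_mono, auto)
    then show ?thesis using plin[of t] by (simp add: algebra_simps abs_le_iff)
  qed
  have pB: "\<bar>p t\<bar> \<le> (k + 1) * d * \<tau>2\<^sup>2" for t
  proof -
    have "(k + 1) * d * bump \<tau>2 t \<le> (k + 1) * d * \<tau>2\<^sup>2" using bump_le[of \<tau>2 t] k d0 by (intro mult_left_mono) auto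
    then show ?thesis using pb[of t] by simp
  qed
  have eq: "x t = (\<integral>v. frac_kernel \<alpha> v * (- \<gamma> * x (t - v)
       + (k * x (t - v - \<tau>1) + n (t - v - \<tau>1) - e * (k * x (t - v - \<tau>1 - \<tau>2) + n (t - v - \<tau>1 - \<tau>2)) - e * p (t - v))) \<partial>lborel)" for t
    unfolding xf[of t] f_eq n_def p_def by simp
  have trans: "char_fun \<alpha> \<gamma> \<tau>1 \<tau>2 k s * laplace x s
     = (exp (- s * of_real \<tau>1) - of_real e * exp (- s * of_real (\<tau>1 + \<tau>2))) * laplace n s - of_real e * laplace p s"
    if "Re s > 0" for s
    unfolding e_def
    by (rule laplace_delay_equation[OF \<alpha>(1) \<tau> that x less_imp_le[OF xB] n nB p pB eq[unfolded e_def]])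
  have E: "norm (exp (- s * of_real \<tau>1) - of_real e * exp (- s * of_real (\<tau>1 + \<tau>2))) \<le> 1 + e" if "Re s > 0" for s
  proof -
    have "norm (exp (- s * of_real \<tau>1)) \<le> 1" "norm (exp (- s * of_real (\<tau>1 + \<tau>2))) \<le> 1" using that \<tau> by auto
    then have "norm (of_real e * exp (- s * of_real (\<tau>1 + \<tau>2))) \<le> e" using e0 by (simp add: norm_mult mult_left_le)
    then show ?thesis using norm_triangle_ineq4 \<open>norm (exp (- s * of_real \<tau>1)) \<le> 1\<close> by (smt (verit))
  qed
  define u n' p' where "u t = x t * exp (- \<sigma> * t)" and "n' t = n t * exp (- \<sigma> * t)" and "p' t = p t * exp (- \<sigma> * t)" for t
  note iu = started_damped_integrable_real[OF x less_imp_le[OF xB] \<sigma>(1), folded u_def]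
  note in' = started_damped_integrable_real[OF n nB \<sigma>(1), folded n'_def]
  note ip = started_damped_integrable_real[OF p pB \<sigma>(1), folded p'_def]
  define U where "U = (\<integral>t. (u t)\<^sup>2 \<partial>lborel)"
  have on_line: "norm (laplace x s) \<le> C * (norm (laplace n s) + norm (laplace p s))"
    if s_def: "s = of_real \<sigma> + \<i> * of_real b" for s :: complex and b
  proof -
    have s: "Re s > 0" using \<sigma> s_def by simp
    let ?N = "norm (laplace n s)" and ?P = "norm (laplace p s)"
    have "c * norm (laplace x s) \<le> norm (char_fun \<alpha> \<gamma> \<tau>1 \<tau>2 k s * laplace x s)"
      using line[of b] by (simp add: norm_mult mult_right_mono s_def)
    also have "\<dots> \<le> norm ((exp (- s * of_real \<tau>1) - of_real e * exp (- s * of_real (\<tau>1 + \<tau>2))) * laplace n s)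
        + norm (of_real e * laplace p s)"
      unfolding trans[OF s] by (rule norm_triangle_ineq4)
    also have "\<dots> \<le> (1 + e) * ?N + (1 + e) * ?P"
      unfolding norm_mult using E[OF s] e0 by (intro add_mono mult_right_mono) auto
    finally show ?thesis using c by (simp add: C_def field_simps)
  qed
  have "U \<le> A * ((\<integral>t. (n' t)\<^sup>2 \<partial>lborel) + (\<integral>t. (p' t)\<^sup>2 \<partial>lborel))"
    unfolding U_def u_def n'_def p'_def A_def
    by (rule damped_energy_bound[OF x less_imp_le[OF xB] n nB p pB \<sigma>(1) on_line]) (rule refl)
  also have "(\<integral>t. (n' t)\<^sup>2 \<partial>lborel) \<le> w * U"
  proof -
    have "(\<integral>t. (n' t)\<^sup>2 \<partial>lborel) \<le> (\<integral>t. w * (u t)\<^sup>2 \<partial>lborel)"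
    proof (rule integral_mono[OF in'(2)])
      show "integrable lborel (\<lambda>t. w * (u t)\<^sup>2)" using iu by simp
      fix t
      have "(n t)\<^sup>2 \<le> (w * x t)\<^sup>2" using nx[of t] w0 by (simp add: abs_le_square_iff[symmetric] abs_mult)
      also have "\<dots> = w * w * (x t)\<^sup>2" by (simp add: power2_eq_square)
      also have "\<dots> \<le> w * 1 * (x t)\<^sup>2" using w0 w1 by (intro mult_right_mono mult_left_mono) auto
      finally have "(n t)\<^sup>2 \<le> w * (x t)\<^sup>2" by simp
      then show "(n' t)\<^sup>2 \<le> w * (u t)\<^sup>2" by (simp add: n'_def u_def power_mult_distrib mult.assoc[symmetric] mult_right_mono)
    qed
    then show ?thesis by (simp add: U_def)
  qed
  also have "(\<integral>t. (p' t)\<^sup>2 \<partial>lborel) \<le> ((k + 1) * d)\<^sup>2 * J"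
  proof -
    have ib: "integrable lborel (\<lambda>t. (bump \<tau>2 t * exp (- \<sigma> * t))\<^sup>2)"
      by (rule started_damped_integrable_real(2)[OF b bump_le \<sigma>(1)])
    have "(\<integral>t. (p' t)\<^sup>2 \<partial>lborel) \<le> (\<integral>t. ((k + 1) * d)\<^sup>2 * (bump \<tau>2 t * exp (- \<sigma> * t))\<^sup>2 \<partial>lborel)"
    proof (rule integral_mono[OF ip(2)])
      show "integrable lborel (\<lambda>t. ((k + 1) * d)\<^sup>2 * (bump \<tau>2 t * exp (- \<sigma> * t))\<^sup>2)" using ib by simp
      fix t
      have "(p t)\<^sup>2 \<le> ((k + 1) * d * bump \<tau>2 t)\<^sup>2"
        using pb[of t] by (simp add: abs_le_square_iff[symmetric])
      then show "(p' t)\<^sup>2 \<le> ((k + 1) * d)\<^sup>2 * (bump \<tau>2 t * exp (- \<sigma> * t))\<^sup>2"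
        by (simp add: p'_def power_mult_distrib mult.assoc[symmetric] mult_right_mono)
    qed
    then show ?thesis by (simp add: J_def)
  qed
  finally have "U \<le> A * (w * U + ((k + 1) * d)\<^sup>2 * J)" using A0 by simp
  also have "\<dots> = (A * w) * U + A * ((k + 1) * d)\<^sup>2 * J" by (simp add: algebra_simps)
  also have "(A * w) * U \<le> 1 / 2 * U" using w1 by (intro mult_right_mono) (auto simp: U_def)
  finally have U: "U \<le> 2 * A * ((k + 1) * d)\<^sup>2 * J" by simp

  define N where "N = (\<integral>t. n t * exp (- \<rho> * t) \<partial>lborel)"
  define P where "P = (\<integral>t. p t * exp (- \<rho> * t) \<partial>lborel)"
  have EN: "e * P \<le> (1 + e) * \<bar>N\<bar>"
  proof -
    have s: "Re (complex_of_real \<rho>) > 0" using root by simp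
    have "of_real e * laplace p (of_real \<rho>)
      = (exp (- of_real \<rho> * of_real \<tau>1) - of_real e * exp (- of_real \<rho> * of_real (\<tau>1 + \<tau>2))) * laplace n (of_real \<rho>)"
      using trans[OF s] root by simp
    then have "norm (of_real e * laplace p (of_real \<rho>)) \<le> (1 + e) * norm (laplace n (of_real \<rho>))"
      using E[OF s] by (simp add: norm_mult mult_right_mono)
    then have "e * \<bar>P\<bar> \<le> (1 + e) * \<bar>N\<bar>" unfolding laplace_of_real P_def N_def using e0 by (simp add: norm_mult)
    moreover have "e * P \<le> e * \<bar>P\<bar>" using e0 by simp
    ultimately show ?thesis by linarith
  qed
  have Plow: "k / 2 * d * m \<le> P"
  proof -
    have "k / 2 * d * m = (\<integral>t. k / 2 * d * (bump \<tau>2 t * exp (- \<rho> * t)) \<partial>lborel)" by (simp add: m_def)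
    also have "\<dots> \<le> P"
      unfolding P_def
    proof (rule integral_mono)
      show "integrable lborel (\<lambda>t. k / 2 * d * (bump \<tau>2 t * exp (- \<rho> * t)))"
        using started_damped_integrable_real(1)[OF b bump_le root(1)] by simp
      show "integrable lborel (\<lambda>t. p t * exp (- \<rho> * t))"
        by (rule started_damped_integrable_real(1)[OF p pB root(1)])
      fix t
      have "w * (d * bump \<tau>2 t) \<le> k / 2 * (d * bump \<tau>2 t)" using w1 d0 bump_nonneg by (intro mult_right_mono) auto
      then have "k / 2 * d * bump \<tau>2 t \<le> p t" using plin[of t] by (simp add: abs_le_iff algebra_simps)
      then show "k / 2 * d * (bump \<tau>2 t * exp (- \<rho> * t)) \<le> p t * exp (- \<rho> * t)"
        unfolding mult.assoc[symmetric] by (intro mult_right_mono) auto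
    qed
    finally show ?thesis .
  qed
  have Nup: "\<bar>N\<bar> \<le> w * d * D"
  proof -
    have "\<bar>N\<bar> \<le> w * (d / (4 * (\<rho> - \<sigma>)) + 1 / (2 * d) * U)"
      unfolding N_def U_def u_def
      by (rule abs_laplace_le_energy[OF x less_imp_le[OF xB] n nB nx less_imp_le[OF w0] d0 \<sigma>])
    also have "\<dots> \<le> w * (d / (4 * (\<rho> - \<sigma>)) + 1 / (2 * d) * (2 * A * ((k + 1) * d)\<^sup>2 * J))"
      using w0 d0 U by (intro mult_left_mono add_left_mono) auto
    also have "1 / (2 * d) * (2 * A * ((k + 1) * d)\<^sup>2 * J) = d * (A * (k + 1)\<^sup>2 * J)"
      using d0 by (simp add: power2_eq_square)
    also have "w * (d / (4 * (\<rho> - \<sigma>)) + d * (A * (k + 1)\<^sup>2 * J)) = w * d * D"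
      by (simp add: D_def distrib_left mult.assoc)
    finally show ?thesis .
  qed
  have "e * (k / 2 * d * m) \<le> e * P" using Plow e0 by simp
  also note EN
  also have "(1 + e) * \<bar>N\<bar> \<le> (1 + e) * (w * d * D)" using Nup e0 by (intro mult_left_mono) auto
  also have "\<dots> \<le> (1 + e) * (w * d * (D + 1))" using e0 w0 d0 by (intro mult_left_mono) auto
  also have "\<dots> = d * ((1 + e) * (D + 1) * w)" by simp
  also have "\<dots> \<le> d * (e * k * m / 4)" using w1 d0 by (intro mult_left_mono) auto
  finally have "d * (e * k * m) \<le> 0" by (simp add: field_simps)
  moreover have "d * (e * k * m) > 0" using d0 e0 k m0 by simp
  ultimately show False by simp
qed

lemma zero_equilibrium:
  assumes "g 0 = 0"
  shows "equilibrium \<alpha> r (delay_rhs \<gamma> \<tau>1 \<tau>2 g) 0"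
  using assms by (simp add: equilibrium_def caputo_dde_solution_def has_caputo_derivative_def delay_rhs_def)

theorem theorem5p2:
  fixes \<alpha> \<gamma> \<tau>1 \<tau>2 k :: real
  assumes "\<gamma> < 0" and "0 < \<alpha>" and "\<alpha> < 1" and "\<tau>1 > 0" and "\<tau>2 > 0"
    and "k > 0" and "k > k_star \<alpha> \<gamma> \<tau>1 \<tau>2"
  shows "(\<exists>z. char_fun \<alpha> \<gamma> \<tau>1 \<tau>2 k z = 0 \<and> Re z > 0) \<and>
    (\<forall>g :: real \<Rightarrow> real.
       g C1_differentiable_on UNIV \<and> \<not> linear g \<and> g 0 = 0 \<and> deriv g 0 = k \<longrightarrow>
       unstable_equilibrium \<alpha> (\<tau>1 + \<tau>2) (delay_rhs \<gamma> \<tau>1 \<tau>2 g) 0)"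
proof -
  obtain x where x: "x > 0" "char_fun \<alpha> \<gamma> \<tau>1 \<tau>2 k (of_real x) = 0"
    using char_fun_positive_root assms by blast
  have "unstable_equilibrium \<alpha> (\<tau>1 + \<tau>2) (delay_rhs \<gamma> \<tau>1 \<tau>2 g) 0"
    if g: "g C1_differentiable_on UNIV" "g 0 = 0" "deriv g 0 = k" for g :: "real \<Rightarrow> real"
  proof -
    have "g differentiable at 0" using g(1) by (simp add: C1_differentiable_on_eq)
    then have "(g has_real_derivative k) (at 0)"
      using g(3) DERIV_deriv_iff_real_differentiable by blast
    moreover have "continuous_on UNIV g" by (rule C1_differentiable_imp_continuous_on) fact
    ultimately show ?thesis
      using not_stable_of_positive_root[OF assms(2-6) x] g zero_equilibrium
      by (simp add: unstable_equilibrium_def)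
  qed
  moreover have "\<exists>z. char_fun \<alpha> \<gamma> \<tau>1 \<tau>2 k z = 0 \<and> Re z > 0"
    using x by (intro exI[of _ "of_real x"]) simp
  ultimately show ?thesis by blast
qed

end
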